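(* Let $m$ be the number of left-invariant vector fields $X_j$ of homogeneity one (i.e. those with $d_j=1$, namely $X_1,\dots,X_m$), with associated coordinates $x_1,\dots,x_m$. Suppose the fixed homogeneous norm $|g|$ is a radial function of the coordinates $(x_1,\dots,x_m)$, i.e. its dependence on these coordinates is only as a smooth function of $x_1^2+\dots+x_m^2$ on $x_1^2+\dots+x_m^2\neq 0$. Then for every $u\in C_0^\infty(\mathbb G)$ and every $g\in\mathbb G$, $$\lim_{s\to 0+}\frac{s}{\sigma_Q}\,\mathcal{L}_s u(g)=u(g)\qquad\text{and}\qquad \lim_{s\to 1-}\frac{2m(1-s)}{\tau_m}\,\mathcal{L}_s u(g)=-\sum_{i=1}^m X_i^2u(g),$$ where $\sigma_Q=\int_{|h|=1}d\sigma(h)$ is the measure of the unit sphere $\{|h|=1\}$ and $$\tau_m=\int_{|h|=1}\sum_{i=1}^m|x_i(h)|^2\,d\sigma(h).$$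
   Context: $\mathbb G$ is a homogeneous group: a connected, simply connected nilpotent Lie group whose Lie algebra $\mathfrak g$ carries a family of automorphisms (dilations) $\{\Delta_\lambda\}_{\lambda>0}$ for which there are a basis $X_1,\dots,X_n$ of $\mathfrak g$ and reals $1=d_1\le d_2\le\dots\le d_n$ with $\Delta_\lambda X_j=\lambda^{d_j}X_j$. The group is not assumed to be Carnot (stratified), and the $X_j$ with $d_j=1$ need not generate $\mathfrak g$. Group dilations are $\delta_\lambda=\exp\circ\Delta_\lambda\circ\exp^{-1}$, and $Q=d_1+\dots+d_n$ is the homogeneous dimension. $dg$ (or $dh$) is a fixed bi-invariant Haar measure (the push-forward of Lebesgue measure on $\mathfrak g$ under $\exp$), so $d(\delta_\lambda g)=\lambda^Q dg$. $|\cdot|$ is a fixed homogeneous norm: $|\cdot|\in C(\mathbb G)\cap C^\infty(\mathbb G\setminus\{e\})$ ($e$ the identity), $|g|\ge 0$ with $|g|=0$ iff $g=e$, $|g^{-1}|=|g|$, $|\delta_\lambda g|=\lambda|g|$, and $|gh|\le|g|+|h|$. $X_j$ also denotes the left-invariant vector field $(X_jf)(g)=\frac{d}{dt}f(g\exp(tX_j))|_{t=0}$. Coordinates $x_1,\dots,x_n$ on $\mathbb G$ are defined by $\exp^{-1}g=\sum_j x_j(g)X_j$. $d\sigma$ is the unique Radon measure on the unit sphere $\{|h|=1\}$ for which the polar coordinates formula $\int_{\mathbb G}u(h)\,dh=\int_0^\infty\int_{|h|=1}u(\delta_r h)\,r^{Q-1}\,d\sigma(h)\,dr$ holds for all $u\in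 L^1(\mathbb G)$. For $0<s<1$, the fractional operator is $$\mathcal{L}_s u(g)=\int_{\mathbb G}\frac{2u(g)-u(gh)-u(gh^{-1})}{|h|^{Q+2s}}\,dh .$$ *)

theory Defs
  imports "HOL-Analysis.Analysis" "HOL-Algebra.Group"
begin

section \<open>Smooth maps and Lie groups\<close>

text \<open>For open \<open>S\<close> in a finite-dimensional space, \<^term>\<open>Ck_on k S f\<close> is the usual \<open>f \<in> C\<^sup>k(S)\<close>:
  derivatives are taken at interior points, and all iterated directional derivatives up to order
  \<open>k\<close> are required to be continuous.\<close>

primrec Ck_on ::
  "nat \<Rightarrow> 'a::real_normed_vector set \<Rightarrow> ('a \<Rightarrow> 'b::real_normed_vector) \<Rightarrow> bool" where
  "Ck_on 0 S f \<longleftrightarrow> continuous_on S f"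
| "Ck_on (Suc k) S f \<longleftrightarrow>
     (\<forall>x\<in>S. f differentiable (at x)) \<and> (\<forall>v. Ck_on k S (\<lambda>x. frechet_derivative f (at x) v))"

definition smooth_on ::
  "'a::real_normed_vector set \<Rightarrow> ('a \<Rightarrow> 'b::real_normed_vector) \<Rightarrow> bool" where
  "smooth_on S f \<longleftrightarrow> (\<forall>k. Ck_on k S f)"

type_synonym ('a, 'e) chart = "'a set \<times> ('a \<Rightarrow> 'e)"

definition is_chart :: "('a::topological_space, 'e::euclidean_space) chart \<Rightarrow> bool" where
  "is_chart = (\<lambda>(U, \<phi>). open U \<and> open (\<phi> ` U) \<and> inj_on \<phi> U \<and>
     homeomorphism U (\<phi> ` U) \<phi> (inv_into U \<phi>))"

definition smooth_atlas :: "('a::topological_space, 'e::euclidean_space) chart set \<Rightarrow> bool" where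
  "smooth_atlas A \<longleftrightarrow> (\<forall>c\<in>A. is_chart c) \<and> (\<Union>(U, \<phi>)\<in>A. U) = UNIV \<and>
     (\<forall>(U, \<phi>)\<in>A. \<forall>(V, \<psi>)\<in>A. smooth_on (\<phi> ` (U \<inter> V)) (\<psi> \<circ> inv_into U \<phi>))"

definition product_atlas ::
  "('a, 'e) chart set \<Rightarrow> ('b, 'f) chart set \<Rightarrow> ('a \<times> 'b, 'e \<times> 'f) chart set" where
  "product_atlas A B = {(U \<times> V, map_prod \<phi> \<psi>) |U \<phi> V \<psi>. (U, \<phi>) \<in> A \<and> (V, \<psi>) \<in> B}"

definition standard_atlas :: "('e, 'e) chart set" where
  "standard_atlas = {(UNIV, id)}"

text \<open>Smoothness, with respect to atlases \<open>A\<close> and \<open>B\<close>, of the restriction of \<open>F\<close> to the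
  open set \<open>W\<close>.\<close>

definition smooth_map_on ::
  "'a set \<Rightarrow> ('a::topological_space, 'e::euclidean_space) chart set \<Rightarrow>
   ('b::topological_space, 'f::euclidean_space) chart set \<Rightarrow> ('a \<Rightarrow> 'b) \<Rightarrow> bool" where
  "smooth_map_on W A B F \<longleftrightarrow> continuous_on W F \<and>
     (\<forall>(U, \<phi>)\<in>A. \<forall>(V, \<psi>)\<in>B.
        smooth_on (\<phi> ` (U \<inter> W \<inter> F -` V)) (\<psi> \<circ> F \<circ> inv_into U \<phi>))"

text \<open>The data of a homogeneous group: an underlying group with a smooth atlas, a basis of its Lie
  algebra (left-invariant vector fields, acting on functions), the exponents \<open>d\<^sub>j\<close>, the dilations
  of the Lie algebra, and the exponential map. The index type \<open>'n\<close> plays the role of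
  \<open>{1,\<dots>,n}\<close>.\<close>

type_synonym 'g vfield = "('g \<Rightarrow> real) \<Rightarrow> 'g \<Rightarrow> real"

record ('g, 'n) homogeneous_data = "'g monoid" +
  atlas :: "('g, real ^ 'n) chart set"
  basis_field :: "'n \<Rightarrow> 'g vfield"
  weight :: "'n \<Rightarrow> real"
  algebra_dilation :: "real \<Rightarrow> 'g vfield \<Rightarrow> 'g vfield"
  exp_map :: "'g vfield \<Rightarrow> 'g"

type_synonym ('g, 'n) hdata = "('g, 'n) homogeneous_data"

definition lie_group :: "('g::{t2_space,second_countable_topology}, 'n::finite) hdata \<Rightarrow> bool" where
  "lie_group G \<longleftrightarrow> group G \<and> carrier G = UNIV \<and> smooth_atlas (atlas G) \<and>
     smooth_map_on UNIV (product_atlas (atlas G) (atlas G)) (atlas G) (\<lambda>(g, h). g \<otimes>\<^bsub>G\<^esub> h) \<and>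
     smooth_map_on UNIV (atlas G) (atlas G) (\<lambda>g. inv\<^bsub>G\<^esub> g)"

section \<open>The Lie algebra and the exponential map\<close>

definition smooth_functions :: "('g::topological_space, 'n::finite) hdata \<Rightarrow> ('g \<Rightarrow> real) set" where
  "smooth_functions G = {f. smooth_map_on UNIV (atlas G) standard_atlas f}"

text \<open>Smooth vector fields are derivations of the algebra of smooth functions. They are set to zero
  on non-smooth functions, so that equality of fields is equality of derivations.\<close>

definition vector_field :: "('g::topological_space, 'n::finite) hdata \<Rightarrow> 'g vfield \<Rightarrow> bool" where
  "vector_field G Y \<longleftrightarrow>
     (\<forall>f\<in>smooth_functions G. Y f \<in> smooth_functions G) \<and>
     (\<forall>f\<in>smooth_functions G. \<forall>h\<in>smooth_functions G. \<forall>c.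
        Y (\<lambda>g. c * f g + h g) = (\<lambda>g. c * Y f g + Y h g)) \<and>
     (\<forall>f\<in>smooth_functions G. \<forall>h\<in>smooth_functions G.
        Y (\<lambda>g. f g * h g) = (\<lambda>g. f g * Y h g + Y f g * h g)) \<and>
     (\<forall>f. f \<notin> smooth_functions G \<longrightarrow> Y f = (\<lambda>g. 0))"

definition lie_algebra :: "('g::topological_space, 'n::finite) hdata \<Rightarrow> 'g vfield set" where
  "lie_algebra G = {Y. vector_field G Y \<and>
     (\<forall>f\<in>smooth_functions G. \<forall>g. Y (\<lambda>h. f (g \<otimes>\<^bsub>G\<^esub> h)) = (\<lambda>h. Y f (g \<otimes>\<^bsub>G\<^esub> h)))}"

definition bracket :: "'g vfield \<Rightarrow> 'g vfield \<Rightarrow> 'g vfield" where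
  "bracket Y Z = (\<lambda>f g. Y (Z f) g - Z (Y f) g)"

definition vf_lin :: "real \<Rightarrow> 'g vfield \<Rightarrow> 'g vfield \<Rightarrow> 'g vfield" where
  "vf_lin c Y Z = (\<lambda>f g. c * Y f g + Z f g)"

definition vf_span :: "'g vfield set \<Rightarrow> 'g vfield set" where
  "vf_span S = {\<lambda>f g. \<Sum>Y\<in>T. c Y * Y f g |T c. finite T \<and> T \<subseteq> S}"

primrec lower_central ::
  "('g::topological_space, 'n::finite) hdata \<Rightarrow> nat \<Rightarrow> 'g vfield set" where
  "lower_central G 0 = lie_algebra G"
| "lower_central G (Suc k) =
     vf_span {bracket Y Z |Y Z. Y \<in> lie_algebra G \<and> Z \<in> lower_central G k}"

definition nilpotent_lie_algebra :: "('g::topological_space, 'n::finite) hdata \<Rightarrow> bool" where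
  "nilpotent_lie_algebra G \<longleftrightarrow> (\<exists>k. lower_central G k = {\<lambda>f g. 0})"

definition lie_algebra_automorphism ::
  "('g::topological_space, 'n::finite) hdata \<Rightarrow> ('g vfield \<Rightarrow> 'g vfield) \<Rightarrow> bool" where
  "lie_algebra_automorphism G \<Phi> \<longleftrightarrow> bij_betw \<Phi> (lie_algebra G) (lie_algebra G) \<and>
     (\<forall>Y\<in>lie_algebra G. \<forall>Z\<in>lie_algebra G.
        (\<forall>c. \<Phi> (vf_lin c Y Z) = vf_lin c (\<Phi> Y) (\<Phi> Z)) \<and>
        \<Phi> (bracket Y Z) = bracket (\<Phi> Y) (\<Phi> Z))"

definition field_of :: "('g, 'n::finite) hdata \<Rightarrow> real ^ 'n \<Rightarrow> 'g vfield" where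
  "field_of G a = (\<lambda>f g. \<Sum>j\<in>UNIV. a $ j * basis_field G j f g)"

definition is_lie_basis :: "('g::topological_space, 'n::finite) hdata \<Rightarrow> bool" where
  "is_lie_basis G \<longleftrightarrow> (\<forall>j. basis_field G j \<in> lie_algebra G) \<and>
     bij_betw (field_of G) UNIV (lie_algebra G)"

text \<open>The exponential map is characterised by the property that \<open>t \<mapsto> exp (t Y)\<close> is the
  one-parameter subgroup with velocity \<open>Y\<close> at the identity.\<close>

definition is_exponential :: "('g::topological_space, 'n::finite) hdata \<Rightarrow> bool" where
  "is_exponential G \<longleftrightarrow> (\<forall>Y\<in>lie_algebra G.
     (\<forall>s t. exp_map G (\<lambda>f g. (s + t) * Y f g) =
              exp_map G (\<lambda>f g. s * Y f g) \<otimes>\<^bsub>G\<^esub> exp_map G (\<lambda>f g. t * Y f g)) \<and>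
     (\<forall>f\<in>smooth_functions G.
        ((\<lambda>t. f (exp_map G (\<lambda>f g. t * Y f g))) has_real_derivative Y f \<one>\<^bsub>G\<^esub>) (at 0)))"

definition log_map :: "('g::topological_space, 'n::finite) hdata \<Rightarrow> 'g \<Rightarrow> 'g vfield" where
  "log_map G = inv_into (lie_algebra G) (exp_map G)"

definition coords :: "('g::topological_space, 'n::finite) hdata \<Rightarrow> 'g \<Rightarrow> real ^ 'n" where
  "coords G g = (THE a. log_map G g = field_of G a)"

text \<open>For a connected, simply connected nilpotent Lie group the exponential map is a global
  diffeomorphism. The library has no Lie theory from which this could be derived, and the objects
  below (group dilations, coordinates, Haar measure) only make sense because of it, so it is recorded
  here as a condition on the data.\<close>

definition exponential_diffeomorphism :: "('g::topological_space, 'n::finite) hdata \<Rightarrow> bool" where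
  "exponential_diffeomorphism G \<longleftrightarrow> bij_betw (exp_map G) (lie_algebra G) UNIV \<and>
     smooth_map_on UNIV standard_atlas (atlas G) (\<lambda>a. exp_map G (field_of G a)) \<and>
     smooth_map_on UNIV (atlas G) standard_atlas (coords G)"

section \<open>Homogeneous groups\<close>

definition homogeneous_group ::
  "('g::{t2_space,second_countable_topology}, 'n::finite) hdata \<Rightarrow> bool" where
  "homogeneous_group G \<longleftrightarrow>
     lie_group G \<and> connected (UNIV :: 'g set) \<and> simply_connected (UNIV :: 'g set) \<and>
     nilpotent_lie_algebra G \<and> is_lie_basis G \<and>
     (\<forall>j. 1 \<le> weight G j) \<and> (\<exists>j. weight G j = 1) \<and>
     (\<forall>r>0. lie_algebra_automorphism G (algebra_dilation G r) \<and>
        (\<forall>j. algebra_dilation G r (basis_field G j) =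
               (\<lambda>f g. r powr weight G j * basis_field G j f g))) \<and>
     is_exponential G \<and> exponential_diffeomorphism G"

definition dilation :: "('g::topological_space, 'n::finite) hdata \<Rightarrow> real \<Rightarrow> 'g \<Rightarrow> 'g" where
  "dilation G r = exp_map G \<circ> algebra_dilation G r \<circ> log_map G"

definition hom_dim :: "('g, 'n::finite) hdata \<Rightarrow> real" where
  "hom_dim G = (\<Sum>j\<in>UNIV. weight G j)"

text \<open>The index set of the basis fields of homogeneity one; its cardinality is \<open>m\<close>.\<close>

definition first_layer :: "('g, 'n::finite) hdata \<Rightarrow> 'n set" where
  "first_layer G = {j. weight G j = 1}"

text \<open>Lebesgue measure on the Lie algebra is normalised by the given basis.\<close>

definition haar :: "('g::topological_space, 'n::finite) hdata \<Rightarrow> 'g measure" where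
  "haar G = distr lborel borel (\<lambda>a. exp_map G (field_of G a))"

definition homogeneous_norm ::
  "('g::topological_space, 'n::finite) hdata \<Rightarrow> ('g \<Rightarrow> real) \<Rightarrow> bool" where
  "homogeneous_norm G N \<longleftrightarrow>
     continuous_on UNIV N \<and> smooth_map_on (UNIV - {\<one>\<^bsub>G\<^esub>}) (atlas G) standard_atlas N \<and>
     (\<forall>g. 0 \<le> N g) \<and> (\<forall>g. N g = 0 \<longleftrightarrow> g = \<one>\<^bsub>G\<^esub>) \<and> (\<forall>g. N (inv\<^bsub>G\<^esub> g) = N g) \<and>
     (\<forall>r>0. \<forall>g. N (dilation G r g) = r * N g) \<and>
     (\<forall>g h. N (g \<otimes>\<^bsub>G\<^esub> h) \<le> N g + N h)"

definition radon_measure_on :: "'a::topological_space set \<Rightarrow> 'a measure \<Rightarrow> bool" where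
  "radon_measure_on S M \<longleftrightarrow> sets M = sets (restrict_space borel S) \<and>
     (\<forall>K. compact K \<and> K \<subseteq> S \<longrightarrow> emeasure M K < \<infinity>) \<and>
     (\<forall>B\<in>sets M. emeasure M B = (SUP K\<in>{K. compact K \<and> K \<subseteq> B}. emeasure M K))"

text \<open>The measure \<open>\<sigma>\<close> on the unit sphere. The polar coordinates formula is understood to include the
  convergence of the iterated integrals, and determines \<open>\<sigma>\<close> uniquely.\<close>

definition sphere_measure ::
  "('g::topological_space, 'n::finite) hdata \<Rightarrow> ('g \<Rightarrow> real) \<Rightarrow> 'g measure \<Rightarrow> bool" where
  "sphere_measure G N \<sigma> \<longleftrightarrow> radon_measure_on {h. N h = 1} \<sigma> \<and>
     (\<forall>u :: 'g \<Rightarrow> real. integrable (haar G) u \<longrightarrow>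
        (AE r in lborel. r > 0 \<longrightarrow> integrable \<sigma> (\<lambda>h. u (dilation G r h) * r powr (hom_dim G - 1))) \<and>
        set_integrable lborel {0<..}
          (\<lambda>r. LINT h|\<sigma>. u (dilation G r h) * r powr (hom_dim G - 1)) \<and>
        (LINT h|haar G. u h) =
          (LINT r:{0<..}|lborel. (LINT h|\<sigma>. u (dilation G r h) * r powr (hom_dim G - 1))))"

text \<open>The first argument of \<open>F\<close> is the sum of squares of the first-layer coordinates, the second one
  carries the remaining coordinates (with the first-layer entries replaced by \<open>0\<close>).\<close>

definition first_layer_radial ::
  "('g::topological_space, 'n::finite) hdata \<Rightarrow> ('g \<Rightarrow> real) \<Rightarrow> bool" where
  "first_layer_radial G N \<longleftrightarrow>
     (\<exists>F :: real \<Rightarrow> real ^ 'n \<Rightarrow> real.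
        (\<forall>y. smooth_on {0<..} (\<lambda>t. F t y)) \<and>
        (\<forall>g. (\<Sum>i\<in>first_layer G. (coords G g $ i)\<^sup>2) \<noteq> 0 \<longrightarrow>
           N g = F (\<Sum>i\<in>first_layer G. (coords G g $ i)\<^sup>2)
                   (\<chi> j. if j \<in> first_layer G then 0 else coords G g $ j)))"

definition test_functions :: "('g::topological_space, 'n::finite) hdata \<Rightarrow> ('g \<Rightarrow> real) set" where
  "test_functions G = {u \<in> smooth_functions G. compact (closure {g. u g \<noteq> 0})}"

definition fractional_op ::
  "('g::topological_space, 'n::finite) hdata \<Rightarrow> ('g \<Rightarrow> real) \<Rightarrow> real \<Rightarrow> ('g \<Rightarrow> real) \<Rightarrow> 'g \<Rightarrow> real" where
  "fractional_op G N s u g =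
     (LINT h|haar G. (2 * u g - u (g \<otimes>\<^bsub>G\<^esub> h) - u (g \<otimes>\<^bsub>G\<^esub> inv\<^bsub>G\<^esub> h)) / N h powr (hom_dim G + 2 * s))"

definition sigma_Q :: "('g \<Rightarrow> real) \<Rightarrow> 'g measure \<Rightarrow> real" where
  "sigma_Q N \<sigma> = measure \<sigma> {h. N h = 1}"

definition tau_m :: "('g::topological_space, 'n::finite) hdata \<Rightarrow> 'g measure \<Rightarrow> real" where
  "tau_m G \<sigma> = (LINT h|\<sigma>. (\<Sum>i\<in>first_layer G. \<bar>coords G h $ i\<bar>\<^sup>2))"

end

theory Submission
  imports Defs
begin

text \<open>Set \<open>q(h) = 2u(g) - u(gh) - u(gh\<^sup>-\<^sup>1)\<close> and let \<open>R\<close> be so large that \<open>q(h) = 2u(g)\<close> for \<open>|h| > R\<close>.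
  By polar coordinates the part \<open>|h| > R\<close> contributes \<open>2u(g) \<sigma>\<^sub>Q R\<^bsup>-2s\<^esup>/(2s)\<close>; this gives the limit \<open>s \<rightarrow> 0\<close>
  and is negligible for \<open>s \<rightarrow> 1\<close>. For \<open>|h| \<le> R\<close>, the Taylor expansion of \<open>t \<mapsto> u(g exp(tY))\<close>, whose
  derivatives are \<open>Y\<^sup>ku(g exp(tY))\<close>, shows that \<open>q\<close> equals \<open>- \<Sum> x\<^sub>i x\<^sub>j X\<^sub>i X\<^sub>j u(g)\<close>, summed over \<open>i, j \<le> m\<close>,
  up to \<open>O(|h|\<^sup>t)\<close> for some \<open>t > 2\<close>, because \<open>|x\<^sub>j(h)| \<le> C|h|\<^bsup>d_j\<^esup>\<close>. The reflections \<open>x\<^sub>i \<mapsto> -x\<^sub>i\<close> and the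
  transpositions of first-layer coordinates preserve both Lebesgue measure and the norm, so the mixed
  moments vanish and the pure ones agree; each of them is \<open>(\<tau>\<^sub>m/m) R\<^bsup>2-2s\<^esup>/(2-2s)\<close>.\<close>

section \<open>Calculus of \<open>C\<^sup>k\<close> functions\<close>

text \<open>The measure on the sphere is accessible only through the polar formula for
  Haar-integrable functions, and this shapes the proof in two ways. Homogeneous integrands are first
  integrated over annuli, where they are bounded on a set of finite measure; balls and their
  complements are then reached by monotone convergence. And the symmetries are applied to moments
  over balls of the norm, where invariance of Lebesgue measure suffices, instead of on the sphere.
  The quadratic part stops at the first layer because a pair \<open>i, j\<close> contributes order
  \<open>d_i + d_j\<close>, which equals 2 only if both weights are 1. There are finitely many
  pairs, so the others stay above 2 by a fixed margin, whatever real values the weights take; this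
  yields the exponent \<open>t\<close>. It keeps the error integral bounded as \<open>s\<close>
  tends to 1, while the quadratic part has a simple pole there that the factor \<open>1 - s\<close>
  cancels. At \<open>s = 0\<close> the pole comes from infinity instead, and the contribution of a
  bounded ball stays bounded.\<close>

lemma Ck_on_cong:
  assumes "open S" "Ck_on k S f" "\<And>x. x \<in> S \<Longrightarrow> f x = g x"
  shows "Ck_on k S g"
  using assms(2,3)
proof (induction k arbitrary: f g)
  case 0
  then show ?case by (simp cong: continuous_on_cong)
next
  case (Suc k)
  \<comment> \<open>On an open set the derivative at a point is determined by the values on the set,
    whatever \<open>f\<close> and \<open>g\<close> do elsewhere.\<close>
  have g: "(g has_derivative frechet_derivative f (at x)) (at x)" if "x \<in> S" for x
    using has_derivative_transform_within_open[OF _ assms(1) that, of f _ UNIV g] Suc.prems that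
    by (simp add: frechet_derivative_works)
  have "Ck_on k S (\<lambda>x. frechet_derivative g (at x) v)" for v
    by (rule Suc.IH[of "\<lambda>x. frechet_derivative f (at x) v"])
      (use Suc.prems frechet_derivative_at[OF g] in auto)
  then show ?case
    using g by (auto simp: differentiable_def)
qed

text \<open>\<open>frechet_derivative\<close> is defined by choice. The closure rules below
  therefore supply an explicit derivative \<open>f'\<close> here and run the induction on its
  directional values.\<close>

lemma Ck_on_Suc_intro:
  assumes "open S" "\<And>x. x \<in> S \<Longrightarrow> (f has_derivative f' x) (at x)"
    and "\<And>v. Ck_on k S (\<lambda>x. f' x v)"
  shows "Ck_on (Suc k) S f"
proof -
  have "f' x = frechet_derivative f (at x)" if "x \<in> S" for x
    using assms(2)[OF that] by (rule frechet_derivative_at)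
  then have "Ck_on k S (\<lambda>x. frechet_derivative f (at x) v)" for v
    using Ck_on_cong[OF assms(1) assms(3)[of v]] by simp
  then show ?thesis
    using assms(2) by (auto simp: differentiable_def)
qed

lemma Ck_on_SucD:
  assumes "Ck_on (Suc k) S f"
  shows "x \<in> S \<Longrightarrow> (f has_derivative frechet_derivative f (at x)) (at x)"
    and "Ck_on k S (\<lambda>x. frechet_derivative f (at x) v)"
  using assms by (auto simp: frechet_derivative_works)

text \<open>In the product and chain rules one factor remains undifferentiated, and the induction
  needs it at the lower order.\<close>

lemma Ck_on_pred: "Ck_on (Suc k) S f \<Longrightarrow> Ck_on k S f"
proof (induction k arbitrary: f)
  case 0
  then show ?case
    by (simp add: continuous_at_imp_continuous_on differentiable_imp_continuous_within)
next
  case (Suc k)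
  have "Ck_on k S (\<lambda>x. frechet_derivative f (at x) v)" for v
    by (rule Suc.IH[OF Ck_on_SucD(2)[OF Suc.prems]])
  moreover have "\<forall>x\<in>S. f differentiable (at x)"
    using Suc.prems by (rule Ck_on.simps(2)[THEN iffD1, THEN conjunct1])
  ultimately show ?case by simp
qed

lemma Ck_on_const: "open S \<Longrightarrow> Ck_on k S (\<lambda>x. c)"
proof (induction k arbitrary: c)
  case (Suc k)
  then show ?case
    by (intro Ck_on_Suc_intro[where f' = "\<lambda>x v. 0"]) auto
qed auto

lemma Ck_on_bounded_linear:
  assumes "open S" "bounded_linear L" "Ck_on k S f"
  shows "Ck_on k S (\<lambda>x. L (f x))"
  using assms(3)
proof (induction k arbitrary: f)
  case 0
  then show ?case
    using bounded_linear.continuous_on[OF assms(2)] by simp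
next
  case (Suc k)
  show ?case
  proof (rule Ck_on_Suc_intro[OF assms(1)])
    show "((\<lambda>x. L (f x)) has_derivative (\<lambda>v. L (frechet_derivative f (at x) v))) (at x)"
      if "x \<in> S" for x
      using bounded_linear.has_derivative[OF assms(2) Ck_on_SucD(1)[OF Suc.prems that]] .
    show "Ck_on k S (\<lambda>x. L (frechet_derivative f (at x) v))" for v
      using Suc.IH[OF Ck_on_SucD(2)[OF Suc.prems]] .
  qed
qed

lemma Ck_on_add:
  assumes "open S" "Ck_on k S f" "Ck_on k S g"
  shows "Ck_on k S (\<lambda>x. f x + g x)"
  using assms(2,3)
proof (induction k arbitrary: f g)
  case 0
  then show ?case by (simp add: continuous_on_add)
next
  case (Suc k)
  show ?case
  proof (rule Ck_on_Suc_intro[OF assms(1)])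
    show "((\<lambda>x. f x + g x) has_derivative
        (\<lambda>v. frechet_derivative f (at x) v + frechet_derivative g (at x) v)) (at x)"
      if "x \<in> S" for x
      using has_derivative_add[OF Ck_on_SucD(1)[OF Suc.prems(1) that]
          Ck_on_SucD(1)[OF Suc.prems(2) that]] .
    show "Ck_on k S (\<lambda>x. frechet_derivative f (at x) v + frechet_derivative g (at x) v)" for v
      using Suc.prems by (intro Suc.IH) auto
  qed
qed

lemma Ck_on_sum:
  assumes "open S" "\<And>i. i \<in> I \<Longrightarrow> Ck_on k S (f i)"
  shows "Ck_on k S (\<lambda>x. \<Sum>i\<in>I. f i x)"
  using assms(2)
  by (induction I rule: infinite_finite_induct) (simp_all add: Ck_on_add Ck_on_const assms(1))

lemma Ck_on_scaleR:
  fixes f :: "'a::real_normed_vector \<Rightarrow> real"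
  assumes "open S" "Ck_on k S f" "Ck_on k S g"
  shows "Ck_on k S (\<lambda>x. f x *\<^sub>R g x)"
  using assms(2,3)
proof (induction k arbitrary: f g)
  case 0
  then show ?case by (simp add: continuous_on_scaleR)
next
  case (Suc k)
  show ?case
  proof (rule Ck_on_Suc_intro[OF assms(1)])
    show "((\<lambda>x. f x *\<^sub>R g x) has_derivative (\<lambda>v. f x *\<^sub>R frechet_derivative g (at x) v +
        frechet_derivative f (at x) v *\<^sub>R g x)) (at x)" if "x \<in> S" for x
      using has_derivative_scaleR[OF Ck_on_SucD(1)[OF Suc.prems(1) that]
          Ck_on_SucD(1)[OF Suc.prems(2) that]] .
    show "Ck_on k S (\<lambda>x. f x *\<^sub>R frechet_derivative g (at x) v +
        frechet_derivative f (at x) v *\<^sub>R g x)" for v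
      using Ck_on_pred[OF Suc.prems(1)] Ck_on_pred[OF Suc.prems(2)] Suc.prems[THEN Ck_on_SucD(2)]
      by (intro Ck_on_add Suc.IH assms(1))
  qed
qed

text \<open>\<open>Ck_on\<close> speaks of derivatives in fixed directions, but the chain rule
  differentiates \<open>f\<close> in the direction \<open>?g' x v\<close>, which moves with
  \<open>x\<close>. Expanding this direction in a basis turns the derivative into a sum of products
  to which the induction applies.\<close>

lemma Ck_on_compose:
  fixes f :: "'b::euclidean_space \<Rightarrow> 'c::real_normed_vector"
  assumes "open S" "g ` S \<subseteq> T" "Ck_on k S g" "Ck_on k T f"
  shows "Ck_on k S (\<lambda>x. f (g x))"
  using assms(3,4)
proof (induction k arbitrary: f)
  case 0
  then show ?case
    using continuous_on_compose2[of T f S g] assms(2) by simp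
next
  case (Suc k)
  let ?f' = "\<lambda>x. frechet_derivative f (at (g x))" and ?g' = "\<lambda>x. frechet_derivative g (at x)"
  have g: "(g has_derivative ?g' x) (at x)" and f: "(f has_derivative ?f' x) (at (g x))"
    if "x \<in> S" for x
    using Suc.prems assms(2) that by (auto simp: frechet_derivative_works)
  have "?f' x (?g' x v) = (\<Sum>b\<in>Basis. (?g' x v \<bullet> b) *\<^sub>R ?f' x b)" if "x \<in> S" for x v
    using linear_sum[OF has_derivative_linear[OF f[OF that]], of "\<lambda>b. (?g' x v \<bullet> b) *\<^sub>R b" Basis]
      linear_scale[OF has_derivative_linear[OF f[OF that]]]
    by (simp add: euclidean_representation)
  then have fg: "((\<lambda>x. f (g x)) has_derivative (\<lambda>v. \<Sum>b\<in>Basis. (?g' x v \<bullet> b) *\<^sub>R ?f' x b)) (at x)"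
    if "x \<in> S" for x
    using has_derivative_compose[OF g f, OF that that] that by simp
  have "Ck_on k S (\<lambda>x. \<Sum>b\<in>Basis. (?g' x v \<bullet> b) *\<^sub>R ?f' x b)" for v
  proof (intro Ck_on_sum Ck_on_scaleR assms(1))
    fix b :: 'b assume "b \<in> Basis"
    show "Ck_on k S (\<lambda>x. ?g' x v \<bullet> b)"
      by (rule Ck_on_bounded_linear[OF assms(1) bounded_linear_inner_left])
        (use Suc.prems in auto)
    show "Ck_on k S (\<lambda>x. ?f' x b)"
      using Suc.IH[OF Ck_on_pred[OF Suc.prems(1)] Ck_on_SucD(2)[OF Suc.prems(2)]] .
  qed
  with fg show ?case
    by (rule Ck_on_Suc_intro[OF assms(1)])
qed

lemma Ck_on_Pair_right:
  assumes "open S"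
  shows "Ck_on k S (\<lambda>x. (c, x))"
proof (cases k)
  case 0
  then show ?thesis by (simp add: continuous_on_Pair)
next
  case (Suc l)
  have "((\<lambda>x. (c, x)) has_derivative (\<lambda>v. (0, v))) (at x)" for x :: 'a
    by (intro has_derivative_Pair has_derivative_const has_derivative_ident)
  then show ?thesis
    unfolding Suc by (rule Ck_on_Suc_intro[OF assms]) (rule Ck_on_const[OF assms])
qed

text \<open>Derivatives and continuity at a point depend only on a neighbourhood of it. This permits
  a different choice of charts at every point when translations are treated.\<close>

lemma Ck_on_local:
  assumes "\<And>x. x \<in> S \<Longrightarrow> \<exists>T. open T \<and> x \<in> T \<and> Ck_on k T f"
  shows "Ck_on k S f"
  using assms
proof (induction k arbitrary: f)
  case 0
  have "isCont f x" if x: "x \<in> S" for x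
  proof -
    obtain T where "open T" "x \<in> T" "continuous_on T f"
      using 0[OF x] by auto
    then show ?thesis
      using continuous_on_eq_continuous_at by blast
  qed
  then show ?case
    by (simp add: continuous_at_imp_continuous_on)
next
  case (Suc k)
  have "Ck_on k S (\<lambda>x. frechet_derivative f (at x) v)" for v
  proof (rule Suc.IH)
    fix x assume "x \<in> S"
    then obtain T where "open T" "x \<in> T" "Ck_on (Suc k) T f"
      using Suc.prems by blast
    then show "\<exists>T. open T \<and> x \<in> T \<and> Ck_on k T (\<lambda>x. frechet_derivative f (at x) v)"
      using Ck_on_SucD(2) by blast
  qed
  moreover have "f differentiable (at x)" if "x \<in> S" for x
    using Suc.prems[OF that] by auto
  ultimately show ?case by simp
qed

section \<open>Smooth functions and left translations\<close>

lemma smooth_functions_iff: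
  "f \<in> smooth_functions G \<longleftrightarrow> continuous_on UNIV f \<and>
     (\<forall>(U, \<phi>)\<in>atlas G. \<forall>k. Ck_on k (\<phi> ` U) (f \<circ> inv_into U \<phi>))"
  by (simp add: smooth_functions_def smooth_map_on_def standard_atlas_def smooth_on_def)

lemma smooth_functions_chart:
  "f \<in> smooth_functions G \<Longrightarrow> (U, \<phi>) \<in> atlas G \<Longrightarrow> Ck_on k (\<phi> ` U) (f \<circ> inv_into U \<phi>)"
  unfolding smooth_functions_iff by blast

lemma smooth_functions_linear:
  assumes "smooth_atlas (atlas G)" "f \<in> smooth_functions G" "h \<in> smooth_functions G"
  shows "(\<lambda>g. c * f g + h g) \<in> smooth_functions G"
  unfolding smooth_functions_iff
proof (intro conjI ballI, safe)
  show "continuous_on UNIV (\<lambda>g. c * f g + h g)"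
    using assms(2,3) by (auto simp: smooth_functions_iff intro!: continuous_intros)
  fix U \<phi> k assume c: "(U, \<phi>) \<in> atlas G"
  have "open (\<phi> ` U)"
    using assms(1) c by (auto simp: smooth_atlas_def is_chart_def)
  then have "Ck_on k (\<phi> ` U) (\<lambda>x. c *\<^sub>R (f \<circ> inv_into U \<phi>) x + (h \<circ> inv_into U \<phi>) x)"
    using smooth_functions_chart[OF assms(2) c] smooth_functions_chart[OF assms(3) c]
    by (intro Ck_on_add Ck_on_scaleR Ck_on_const)
  then show "Ck_on k (\<phi> ` U) ((\<lambda>g. c * f g + h g) \<circ> inv_into U \<phi>)"
    by (simp add: o_def)
qed

lemma smooth_functions_zero:
  assumes "smooth_atlas (atlas G)"
  shows "(\<lambda>g. 0) \<in> smooth_functions G"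
  using assms unfolding smooth_functions_iff o_def
  by (auto simp: smooth_atlas_def is_chart_def intro!: Ck_on_const)

text \<open>A vector field is additive only on smooth functions, so smoothness of the partial sums
  is carried through the same induction.\<close>

lemma vector_field_sum:
  assumes "smooth_atlas (atlas G)" "vector_field G Y" "\<And>i. i \<in> I \<Longrightarrow> f i \<in> smooth_functions G"
  shows "(\<lambda>g. \<Sum>i\<in>I. c i * f i g) \<in> smooth_functions G \<and>
    Y (\<lambda>g. \<Sum>i\<in>I. c i * f i g) = (\<lambda>g. \<Sum>i\<in>I. c i * Y (f i) g)"
proof -
  have lin: "Y (\<lambda>g. c * f g + h g) = (\<lambda>g. c * Y f g + Y h g)"
    if "f \<in> smooth_functions G" "h \<in> smooth_functions G" for f h c
    using assms(2) that unfolding vector_field_def by blast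
  have "Y (\<lambda>g. 0) g = 0" for g
    using fun_cong[OF lin[of "\<lambda>g. 0" "\<lambda>g. 0" 1], of g] smooth_functions_zero[OF assms(1)] by simp
  then show ?thesis
    using assms(3)
  proof (induction I rule: infinite_finite_induct)
    case (insert i I)
    then have "f i \<in> smooth_functions G" "(\<lambda>g. \<Sum>i\<in>I. c i * f i g) \<in> smooth_functions G"
      by auto
    from smooth_functions_linear[OF assms(1) this, of "c i"] lin[OF this, of "c i"] insert
    show ?case by simp
  qed (auto simp: smooth_functions_zero[OF assms(1)])
qed

text \<open>In charts, left translation is the smooth group law with its first argument frozen at
  \<open>g\<close>, precomposed with the slice \<open>q \<mapsto> (\<phi> g, q)\<close>. Three
  charts are involved, around \<open>g\<close>, around \<open>h\<close> and around their product;
  they fit together only near \<open>h\<close>, so the argument is local.\<close>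

lemma smooth_functions_translate:
  assumes "lie_group G" "f \<in> smooth_functions G"
  shows "(\<lambda>h. f (g \<otimes>\<^bsub>G\<^esub> h)) \<in> smooth_functions G"
proof -
  let ?A = "atlas G" and ?mult = "\<lambda>(g, h). g \<otimes>\<^bsub>G\<^esub> h"
  have atl: "smooth_atlas ?A" and mult: "smooth_map_on UNIV (product_atlas ?A ?A) ?A ?mult"
    using assms(1) by (auto simp: lie_group_def)
  have "continuous_on UNIV ?mult"
    using mult by (simp add: smooth_map_on_def)
  then have cont: "continuous_on UNIV (\<lambda>h. g \<otimes>\<^bsub>G\<^esub> h)"
    using continuous_on_compose2[of UNIV ?mult UNIV "Pair g"] by (simp add: continuous_on_Pair)
  have cover: "\<exists>U \<phi>. (U, \<phi>) \<in> ?A \<and> x \<in> U" for x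
  proof -
    have "x \<in> (\<Union>(U, \<phi>)\<in>?A. U)"
      using atl by (simp add: smooth_atlas_def)
    then show ?thesis by auto
  qed
  have chart: "is_chart (U, \<phi>)" if "(U, \<phi>) \<in> ?A" for U \<phi>
    using atl that by (auto simp: smooth_atlas_def)
  show ?thesis
    unfolding smooth_functions_iff
  proof (intro conjI ballI, safe)
    show "continuous_on UNIV (\<lambda>h. f (g \<otimes>\<^bsub>G\<^esub> h))"
      using continuous_on_compose2[OF _ cont, of UNIV f] assms(2) by (simp add: smooth_functions_iff)
    fix V \<psi> k assume V: "(V, \<psi>) \<in> ?A"
    show "Ck_on k (\<psi> ` V) ((\<lambda>h. f (g \<otimes>\<^bsub>G\<^esub> h)) \<circ> inv_into V \<psi>)"
    proof (rule Ck_on_local)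
      fix p assume "p \<in> \<psi> ` V"
      then obtain h where h: "h \<in> V" "p = \<psi> h" by auto
      obtain U \<phi> where U: "(U, \<phi>) \<in> ?A" "g \<in> U" using cover by blast
      obtain W \<theta> where W: "(W, \<theta>) \<in> ?A" "g \<otimes>\<^bsub>G\<^esub> h \<in> W" using cover by blast
      \<comment> \<open>\<open>O'\<close> is the part of the chart at \<open>h\<close> that
        translation by \<open>g\<close> sends into \<open>W\<close>; it is open because
        \<open>\<psi>\<close> is a homeomorphism onto an open set.\<close>
      define O' where "O' = \<psi> ` (V \<inter> (\<lambda>h. g \<otimes>\<^bsub>G\<^esub> h) -` W)"
      have inj: "inj_on \<phi> U" "inj_on \<psi> V" "inj_on \<theta> W"
        using chart U V W by (auto simp: is_chart_def)
      have opens: "open V" "open (\<psi> ` V)" "open W" "homeomorphism V (\<psi> ` V) \<psi> (inv_into V \<psi>)"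
        using chart V W by (auto simp: is_chart_def)
      have "open ((\<lambda>h. g \<otimes>\<^bsub>G\<^esub> h) -` W)"
        using cont opens by (simp add: open_vimage)
      then have "openin (top_of_set V) (V \<inter> (\<lambda>h. g \<otimes>\<^bsub>G\<^esub> h) -` W)"
        by (simp add: openin_open_Int)
      then have openO: "open O'"
        unfolding O'_def using homeomorphism_imp_open_map[OF opens(4)] openin_open_trans opens(2)
        by blast
      let ?T = "map_prod \<phi> \<psi> ` ((U \<times> V) \<inter> UNIV \<inter> ?mult -` W)"
      let ?m = "\<theta> \<circ> ?mult \<circ> inv_into (U \<times> V) (map_prod \<phi> \<psi>)"
      have "(U \<times> V, map_prod \<phi> \<psi>) \<in> product_atlas ?A ?A"
        using U V by (auto simp: product_atlas_def)
      then have m: "Ck_on k ?T ?m"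
        using mult W(1) unfolding smooth_map_on_def smooth_on_def by blast
      have in_T: "(\<phi> g, q) \<in> ?T" if "q \<in> O'" for q
        using that U by (force simp: O'_def)
      have m_eq: "?m (\<phi> g, \<psi> h') = \<theta> (g \<otimes>\<^bsub>G\<^esub> h')" if "h' \<in> V" for h'
      proof -
        have "inv_into (U \<times> V) (map_prod \<phi> \<psi>) (map_prod \<phi> \<psi> (g, h')) = (g, h')"
          using map_prod_inj_on[OF inj(1,2)] U that by (intro inv_into_f_f) auto
        then show ?thesis by simp
      qed
      have m_eq': "?m (\<phi> g, q) \<in> \<theta> ` W \<and>
          (f \<circ> inv_into W \<theta>) (?m (\<phi> g, q)) = ((\<lambda>h. f (g \<otimes>\<^bsub>G\<^esub> h)) \<circ> inv_into V \<psi>) q"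
        if "q \<in> O'" for q
      proof -
        from that obtain h' where h': "h' \<in> V" "g \<otimes>\<^bsub>G\<^esub> h' \<in> W" "q = \<psi> h'"
          by (auto simp: O'_def)
        then have "inv_into V \<psi> q = h'" "inv_into W \<theta> (\<theta> (g \<otimes>\<^bsub>G\<^esub> h')) = g \<otimes>\<^bsub>G\<^esub> h'"
          using inj by (simp_all add: inv_into_f_f)
        then show ?thesis
          using m_eq[OF h'(1)] h' by simp
      qed
      have Ck_m: "Ck_on k O' (\<lambda>q. ?m (\<phi> g, q))"
        by (rule Ck_on_compose[OF openO _ Ck_on_Pair_right[OF openO] m]) (use in_T in blast)
      have "Ck_on k O' (\<lambda>q. (f \<circ> inv_into W \<theta>) (?m (\<phi> g, q)))"
        by (rule Ck_on_compose[OF openO _ Ck_m smooth_functions_chart[OF assms(2) W(1)]])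
          (use m_eq' in blast)
      then have "Ck_on k O' ((\<lambda>h. f (g \<otimes>\<^bsub>G\<^esub> h)) \<circ> inv_into V \<psi>)"
        by (rule Ck_on_cong[OF openO]) (use m_eq' in blast)
      moreover have "p \<in> O'"
        using h W(2) by (auto simp: O'_def)
      ultimately show "\<exists>T. open T \<and> p \<in> T \<and> Ck_on k T ((\<lambda>h. f (g \<otimes>\<^bsub>G\<^esub> h)) \<circ> inv_into V \<psi>)"
        using openO by blast
    qed
  qed
qed

section \<open>Exponential coordinates\<close>

locale homogeneous_lie_group =
  fixes G :: "('g::{t2_space,second_countable_topology}, 'n::finite) hdata"
  assumes homogeneous_group: "homogeneous_group G"
begin

abbreviation mult (infixl "\<odot>" 70) where "g \<odot> h \<equiv> g \<otimes>\<^bsub>G\<^esub> h"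

text \<open>Exponential coordinates of the first kind. In them Haar measure becomes Lebesgue
  measure, inversion becomes \<open>a \<mapsto> - a\<close>, and the group dilations become the
  diagonal maps \<open>dil r\<close>.\<close>

definition Exp :: "real ^ 'n \<Rightarrow> 'g" where
  "Exp a = exp_map G (field_of G a)"

definition dil :: "real \<Rightarrow> real ^ 'n \<Rightarrow> real ^ 'n" where
  "dil r a = (\<chi> j. r powr weight G j * a $ j)"

lemma lie_group: "lie_group G" and lie_basis: "is_lie_basis G"
  and exponential: "is_exponential G" and exp_diffeo: "exponential_diffeomorphism G"
  using homogeneous_group by (auto simp: homogeneous_group_def)

lemma group: "group G" and carrier: "carrier G = UNIV" and smooth_atlas: "smooth_atlas (atlas G)"
  using lie_group by (auto simp: lie_group_def)

lemma weight_ge_1: "1 \<le> weight G j"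
  using homogeneous_group by (auto simp: homogeneous_group_def)

lemma assoc: "x \<odot> y \<odot> z = x \<odot> (y \<odot> z)"
  using group.is_monoid[OF group] carrier by (simp add: monoid.m_assoc)

lemma r_one: "x \<odot> \<one>\<^bsub>G\<^esub> = x"
  using group.is_monoid[OF group] carrier by simp

lemma field_of_inj: "field_of G a = field_of G b \<longleftrightarrow> a = b"
  using lie_basis by (auto simp: is_lie_basis_def bij_betw_def inj_on_def)

lemma range_field_of: "range (field_of G) = lie_algebra G"
  using lie_basis by (auto simp: is_lie_basis_def bij_betw_def)

lemma field_of_in: "field_of G a \<in> lie_algebra G"
  using range_field_of by blast

lemma basis_field_in: "basis_field G j \<in> lie_algebra G"
  using lie_basis by (auto simp: is_lie_basis_def)

lemma vector_field: "Y \<in> lie_algebra G \<Longrightarrow> vector_field G Y"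
  by (simp add: lie_algebra_def)

lemma smooth_field: "Y \<in> lie_algebra G \<Longrightarrow> f \<in> smooth_functions G \<Longrightarrow> Y f \<in> smooth_functions G"
  using vector_field unfolding vector_field_def by blast

lemma exp_bij: "inj_on (exp_map G) (lie_algebra G)" "exp_map G ` lie_algebra G = UNIV"
  using exp_diffeo by (auto simp: exponential_diffeomorphism_def bij_betw_def)

lemma log_Exp: "log_map G (Exp a) = field_of G a"
  unfolding log_map_def Exp_def using exp_bij(1) field_of_in by (rule inv_into_f_f)

lemma coords_Exp [simp]: "coords G (Exp a) = a"
  by (simp add: coords_def log_Exp field_of_inj)

lemma surj_Exp: "\<exists>a. g = Exp a"
  using exp_bij(2) range_field_of unfolding Exp_def by (metis UNIV_I imageE)

lemma Exp_coords [simp]: "Exp (coords G g) = g"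
  using surj_Exp[of g] by auto

lemma continuous_Exp: "continuous_on UNIV Exp"
  using exp_diffeo by (simp add: exponential_diffeomorphism_def smooth_map_on_def Exp_def[abs_def])

lemma continuous_coords: "continuous_on UNIV (coords G)"
  using exp_diffeo by (simp add: exponential_diffeomorphism_def smooth_map_on_def)

lemma continuous_mult: "continuous_on UNIV (\<lambda>h. g \<odot> h)"
proof -
  have "continuous_on UNIV (\<lambda>(g, h). g \<odot> h)"
    using lie_group by (simp add: lie_group_def smooth_map_on_def)
  then show ?thesis
    using continuous_on_compose2[of UNIV "\<lambda>(g, h). g \<odot> h" UNIV "Pair g"]
    by (simp add: continuous_on_Pair)
qed

section \<open>One-parameter subgroups and differentiation along them\<close>

lemma field_of_scale: "(\<lambda>f g. s * field_of G a f g) = field_of G (s *\<^sub>R a)"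
  by (simp add: field_of_def sum_distrib_left mult.assoc)

lemma Exp_add: "Exp ((s + t) *\<^sub>R a) = Exp (s *\<^sub>R a) \<odot> Exp (t *\<^sub>R a)"
  using bspec[OF exponential[unfolded is_exponential_def] field_of_in[of a], THEN conjunct1]
  by (simp add: field_of_scale Exp_def)

lemma Exp_0: "Exp 0 = \<one>\<^bsub>G\<^esub>"
proof -
  have "Exp 0 \<odot> Exp 0 = Exp 0"
    using Exp_add[of 0 0 0] by simp
  then show ?thesis
    using group.l_cancel_one[OF group] carrier by simp
qed

lemma inv_Exp: "inv\<^bsub>G\<^esub> (Exp a) = Exp (- a)"
proof -
  have "Exp (- a) \<odot> Exp a = \<one>\<^bsub>G\<^esub>"
    using Exp_add[of "-1" 1 a] by (simp add: Exp_0)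
  then show ?thesis
    using group.inv_equality[OF group] carrier by simp
qed

text \<open>\<open>is_exponential\<close> gives the derivative only at time 0 and at the identity.
  Translating \<open>f\<close> by the point reached at time \<open>t\<close> and using left
  invariance moves it to every \<open>t\<close> and every \<open>g\<close>.\<close>

lemma field_derivative:
  assumes "f \<in> smooth_functions G"
  shows "((\<lambda>t. f (g \<odot> Exp (t *\<^sub>R a))) has_real_derivative
    field_of G a f (g \<odot> Exp (t *\<^sub>R a))) (at t)"
proof -
  let ?Y = "field_of G a" and ?g = "g \<odot> Exp (t *\<^sub>R a)"
  let ?h = "\<lambda>h. f (?g \<odot> h)"
  have h: "?h \<in> smooth_functions G"
    by (rule smooth_functions_translate[OF lie_group assms])
  have "?Y ?h = (\<lambda>h. ?Y f (?g \<odot> h))"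
    using field_of_in[of a] assms unfolding lie_algebra_def by blast
  then have "?Y ?h \<one>\<^bsub>G\<^esub> = ?Y f ?g"
    by (simp add: r_one)
  moreover have "((\<lambda>s. ?h (Exp (s *\<^sub>R a))) has_real_derivative ?Y ?h \<one>\<^bsub>G\<^esub>) (at 0)"
    using bspec[OF bspec[OF exponential[unfolded is_exponential_def] field_of_in[of a],
          THEN conjunct2] h]
    by (simp add: field_of_scale Exp_def)
  moreover have "?h (Exp (s *\<^sub>R a)) = f (g \<odot> Exp ((s + t) *\<^sub>R a))" for s
    by (simp add: Exp_add[of t s a, unfolded add.commute[of t s]] assoc)
  ultimately have "((\<lambda>s. f (g \<odot> Exp ((s + t) *\<^sub>R a))) has_real_derivative ?Y f ?g) (at 0)"
    by simp
  then show ?thesis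
    using DERIV_shift[of "\<lambda>t. f (g \<odot> Exp (t *\<^sub>R a))" "?Y f ?g" 0 t] by simp
qed

text \<open>Third-order expansion in \<open>t\<close> along the curve through \<open>g\<close>, read
  at the times 1 and -1: the first-order terms cancel in the sum. The two remainders keep their own
  intermediate times \<open>t1\<close> and \<open>t2\<close>, with opposite signs because of the
  cube.\<close>

lemma Taylor_Exp:
  fixes a :: "real ^ 'n"
  assumes "u \<in> smooth_functions G"
  defines "Y \<equiv> field_of G a"
  obtains t1 t2 where "\<bar>t1\<bar> \<le> 1" "\<bar>t2\<bar> \<le> 1"
    "u (g \<odot> Exp a) + u (g \<odot> Exp (- a)) - 2 * u g =
      Y (Y u) g + (Y (Y (Y u)) (g \<odot> Exp (t1 *\<^sub>R a)) - Y (Y (Y u)) (g \<odot> Exp (t2 *\<^sub>R a))) / 6"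
proof -
  define diff where "diff m t = (Y ^^ m) u (g \<odot> Exp (t *\<^sub>R a))" for m t
  have "(Y ^^ m) u \<in> smooth_functions G" for m
    by (induction m) (simp_all add: assms smooth_field field_of_in)
  then have "DERIV (diff m) t :> diff (Suc m) t" for m t
    using field_derivative[of "(Y ^^ m) u" g a t] by (simp add: diff_def[abs_def] Y_def)
  then have D: "\<forall>m t. DERIV (diff m) t :> diff (Suc m) t" by blast
  have diff_0: "diff 0 0 = u g" "diff 2 0 = Y (Y u) g"
    by (simp_all only: diff_def scaleR_zero_left Exp_0 r_one numeral_2_eq_2 funpow.simps o_def id_def)
  have diff_3: "diff 3 t = Y (Y (Y u)) (g \<odot> Exp (t *\<^sub>R a))" for t
    by (simp only: diff_def numeral_3_eq_3 funpow.simps o_def id_def)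
  have sum: "(\<Sum>m<3. f m) = f 0 + f 1 + f 2" for f :: "nat \<Rightarrow> real"
    by (simp add: numeral_3_eq_3 numeral_2_eq_2)
  have fact_3: "fact 3 = (6 :: real)"
    by (simp add: fact_numeral)
  have "\<exists>t. \<bar>t\<bar> \<le> \<bar>x\<bar> \<and> diff 0 x = u g + diff 1 0 * x + Y (Y u) g / 2 * x\<^sup>2 + diff 3 t / 6 * x ^ 3" for x
    using Maclaurin_all_le[OF refl D, of x 3] unfolding sum diff_0 fact_3 by simp
  from this[of 1] this[of "- 1"] obtain t1 t2 where t: "\<bar>t1\<bar> \<le> 1" "\<bar>t2\<bar> \<le> 1"
    "diff 0 1 = u g + diff 1 0 + Y (Y u) g / 2 + diff 3 t1 / 6"
    "diff 0 (- 1) = u g - diff 1 0 + Y (Y u) g / 2 - diff 3 t2 / 6"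
    by auto
  have "diff 0 1 = u (g \<odot> Exp a)" "diff 0 (- 1) = u (g \<odot> Exp (- a))"
    by (simp_all add: diff_def)
  note t = t[unfolded this diff_3]
  have "p + q - 2 * U = V + (A - B) / 6" if "p = U + D + V / 2 + A / 6" "q = U - D + V / 2 - B / 6"
    for p q U D V A B :: real
    unfolding that by (simp add: field_simps)
  from that[OF t(1,2) this[OF t(3,4)]] show ?thesis .
qed

section \<open>Iterated left-invariant derivatives in terms of the basis\<close>

lemma field_of_apply: "field_of G a f g = (\<Sum>j\<in>UNIV. a $ j * basis_field G j f g)"
  by (simp add: field_of_def)

text \<open>The components of \<open>a\<close> are constants, so no derivative falls on them. The
  basis fields need not commute, hence the order of the indices is kept.\<close>

lemma field_of_2:
  assumes "u \<in> smooth_functions G"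
  shows "field_of G a (field_of G a u) g =
    (\<Sum>i\<in>UNIV. \<Sum>j\<in>UNIV. a $ i * a $ j * basis_field G i (basis_field G j u) g)"
proof -
  have "basis_field G i (field_of G a u) g = (\<Sum>j\<in>UNIV. a $ j * basis_field G i (basis_field G j u) g)"
    for i g
    unfolding field_of_def
    using vector_field_sum[OF smooth_atlas vector_field[OF basis_field_in],
        where f = "\<lambda>j. basis_field G j u" and c = "\<lambda>j. a $ j"] smooth_field[OF basis_field_in assms]
    by simp
  then show ?thesis
    by (simp add: field_of_apply[of a "field_of G a u"] sum_distrib_left mult.assoc)
qed

lemma field_of_3:
  assumes "u \<in> smooth_functions G"
  shows "field_of G a (field_of G a (field_of G a u)) g =
    (\<Sum>i\<in>UNIV. \<Sum>j\<in>UNIV. \<Sum>k\<in>UNIV.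
      a $ i * a $ j * a $ k * basis_field G i (basis_field G j (basis_field G k u)) g)"
proof -
  have sm: "basis_field G k u \<in> smooth_functions G" for k
    using smooth_field[OF basis_field_in assms] .
  have "basis_field G j (field_of G a u) = (\<lambda>g. \<Sum>k\<in>UNIV. a $ k * basis_field G j (basis_field G k u) g)"
    for j
    unfolding field_of_def
    using vector_field_sum[OF smooth_atlas vector_field[OF basis_field_in],
        where f = "\<lambda>j. basis_field G j u" and c = "\<lambda>j. a $ j"] sm by simp
  moreover have "basis_field G i (\<lambda>g. \<Sum>k\<in>UNIV. a $ k * basis_field G j (basis_field G k u) g) g =
      (\<Sum>k\<in>UNIV. a $ k * basis_field G i (basis_field G j (basis_field G k u)) g)" for i j g
    using vector_field_sum[OF smooth_atlas vector_field[OF basis_field_in],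
        where f = "\<lambda>k. basis_field G j (basis_field G k u)" and c = "\<lambda>j. a $ j"]
      smooth_field[OF basis_field_in sm] by simp
  ultimately show ?thesis
    using field_of_2[OF smooth_field[OF field_of_in assms]]
    by (simp add: sum_distrib_left mult.assoc)
qed

text \<open>Linearity of an automorphism is stated for two fields at a time, so the coordinates of
  \<open>a\<close> are switched on one after the other, by induction on the index set
  \<open>I\<close>.\<close>

lemma dilation_Exp:
  assumes "r > 0"
  shows "dilation G r (Exp a) = Exp (dil r a)"
proof -
  let ?D = "algebra_dilation G r"
  have lin: "?D (vf_lin c Y Z) = vf_lin c (?D Y) (?D Z)"
    if "Y \<in> lie_algebra G" "Z \<in> lie_algebra G" for c Y Z
    using homogeneous_group assms that
    unfolding homogeneous_group_def lie_algebra_automorphism_def by blast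
  have basis: "?D (basis_field G j) = (\<lambda>f g. r powr weight G j * basis_field G j f g)" for j
    using homogeneous_group assms unfolding homogeneous_group_def by blast
  have "?D (field_of G (\<chi> j. if j \<in> I then a $ j else 0)) =
      field_of G (\<chi> j. if j \<in> I then r powr weight G j * a $ j else 0)" for I :: "'n set"
    using finite[of I]
  proof (induction I)
    case empty
    \<comment> \<open>Writing the zero field as \<open>- 0 + 0\<close> shows that its image has the
      form \<open>- Z + Z\<close>, hence is zero.\<close>
    have "vf_lin (- 1) (field_of G 0) (field_of G 0) = field_of G 0"
      by (simp add: vf_lin_def field_of_def)
    then have "?D (field_of G 0) = vf_lin (- 1) (?D (field_of G 0)) (?D (field_of G 0))"
      using lin[OF field_of_in field_of_in] by metis
    then have "?D (field_of G 0) = field_of G 0"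
      by (simp add: vf_lin_def field_of_def)
    then show ?case by (simp add: zero_vec_def)
  next
    case (insert i I)
    have eq: "field_of G (\<chi> j. if j \<in> insert i I then b $ j else 0) =
        vf_lin (b $ i) (basis_field G i) (field_of G (\<chi> j. if j \<in> I then b $ j else 0))" for b
    proof -
      have "(\<Sum>j\<in>UNIV. (if j \<in> insert i I then b $ j else 0) * h j) =
          b $ i * h i + (\<Sum>j\<in>UNIV. (if j \<in> I then b $ j else 0) * h j)" for h :: "'n \<Rightarrow> real"
      proof -
        have sum_if: "(\<Sum>j\<in>UNIV. (if j \<in> J then b $ j else 0) * h j) = (\<Sum>j\<in>J. b $ j * h j)" for J
        proof -
          have "(\<Sum>j\<in>UNIV. (if j \<in> J then b $ j else 0) * h j) =
              (\<Sum>j\<in>UNIV. if j \<in> J then b $ j * h j else 0)"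
            by (intro sum.cong) auto
          then show ?thesis by (simp add: sum.If_cases)
        qed
        then show ?thesis
          unfolding sum_if using insert.hyps by simp
      qed
      then show ?thesis
        by (simp add: vf_lin_def field_of_def)
    qed
    have "?D (field_of G (\<chi> j. if j \<in> insert i I then a $ j else 0)) =
        vf_lin (a $ i) (?D (basis_field G i)) (?D (field_of G (\<chi> j. if j \<in> I then a $ j else 0)))"
      unfolding eq by (rule lin[OF basis_field_in field_of_in])
    also have "\<dots> = vf_lin (dil r a $ i) (basis_field G i)
        (field_of G (\<chi> j. if j \<in> I then dil r a $ j else 0))"
      unfolding basis insert.IH vf_lin_def dil_def vec_lambda_beta by (simp add: mult_ac)
    also have "\<dots> = field_of G (\<chi> j. if j \<in> insert i I then dil r a $ j else 0)"
      by (rule eq[symmetric])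
    finally show ?case
      by (simp only: dil_def vec_lambda_beta)
  qed
  from this[of UNIV] have "?D (field_of G a) = field_of G (dil r a)"
    by (simp add: dil_def)
  then show ?thesis
    by (simp add: dilation_def log_Exp Exp_def[of "dil r a"])
qed

end

section \<open>Homogeneous norm and Haar measure\<close>

text \<open>Lebesgue measure is determined by its values on boxes, and a signed permutation of the
  coordinates pulls a box back to a box with the same side lengths up to order. Reflections are the
  case \<open>\<pi> = id\<close>, transpositions the case of constant sign 1.\<close>

lemma distr_lborel_signed_involution:
  fixes \<pi> :: "'n::finite \<Rightarrow> 'n" and \<epsilon> :: "'n \<Rightarrow> real"
  assumes inv: "\<And>j. \<pi> (\<pi> j) = j" and sgn: "\<And>j. \<epsilon> j = 1 \<or> \<epsilon> j = - 1"
  defines "T \<equiv> \<lambda>a :: real ^ 'n. \<chi> j. \<epsilon> j * a $ \<pi> j"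
  shows "distr lborel borel T = lborel"
proof (rule lborel_eqI[symmetric])
  fix l u :: "real ^ 'n" assume lu: "\<And>b. b \<in> Basis \<Longrightarrow> l \<bullet> b \<le> u \<bullet> b"
  have le: "l $ j \<le> u $ j" for j
    using lu[of "axis j 1"] by (simp add: inner_axis axis_in_Basis_iff)
  \<comment> \<open>The coordinate with index \<open>k\<close> is constrained by row
    \<open>\<pi> k\<close>, because \<open>\<pi> (\<pi> k) = k\<close>. A negative sign there
    negates and exchanges the two endpoints.\<close>
  define l' u' where "l' = (\<chi> k. if \<epsilon> (\<pi> k) = 1 then l $ \<pi> k else - u $ \<pi> k)"
    and "u' = (\<chi> k. if \<epsilon> (\<pi> k) = 1 then u $ \<pi> k else - l $ \<pi> k)"
  have prod_Basis: "(\<Prod>b\<in>Basis. (y - x) \<bullet> b) = (\<Prod>i\<in>UNIV. y $ i - x $ i)" for x y :: "real ^ 'n"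
    by (simp add: Basis_vec_def cart_eq_inner_axis axis_eq_axis prod.UNION_disjoint inner_diff_left)
  have "continuous_on UNIV T"
    unfolding T_def by (intro continuous_intros)
  then have T: "T \<in> borel_measurable borel"
    by (rule borel_measurable_continuous_onI)
  have "l $ j < \<epsilon> j * a $ \<pi> j \<and> \<epsilon> j * a $ \<pi> j < u $ j \<longleftrightarrow> l' $ \<pi> j < a $ \<pi> j \<and> a $ \<pi> j < u' $ \<pi> j" for a j
    using sgn[of j] by (auto simp: l'_def u'_def inv)
  then have "a \<in> T -` box l u \<longleftrightarrow> (\<forall>j. l' $ \<pi> j < a $ \<pi> j \<and> a $ \<pi> j < u' $ \<pi> j)" for a
    by (simp add: T_def mem_box_cart)
  also have "\<dots> a \<longleftrightarrow> a \<in> box l' u'" for a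
    unfolding mem_box_cart by (metis inv)
  finally have "T -` box l u = box l' u'" by blast
  then have "emeasure (distr lborel borel T) (box l u) = emeasure lborel (box l' u')"
    using T by (simp add: emeasure_distr)
  also have "\<dots> = (\<Prod>b\<in>Basis. (u' - l') \<bullet> b)"
  proof (rule emeasure_lborel_box)
    fix b :: "real ^ 'n" assume "b \<in> Basis"
    then obtain k where "b = axis k 1" by (auto simp: Basis_vec_def)
    then show "l' \<bullet> b \<le> u' \<bullet> b"
      using le[of "\<pi> k"] by (simp add: inner_axis l'_def u'_def)
  qed
  also have "(\<Prod>b\<in>Basis. (u' - l') \<bullet> b) = (\<Prod>k\<in>UNIV. u $ \<pi> k - l $ \<pi> k)"
    unfolding prod_Basis by (intro prod.cong) (auto simp: l'_def u'_def)
  also have "\<dots> = (\<Prod>k\<in>UNIV. u $ k - l $ k)"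
    by (rule prod.reindex_bij_witness[of _ \<pi> \<pi>]) (auto simp: inv)
  finally show "emeasure (distr lborel borel T) (box l u) = (\<Prod>b\<in>Basis. (u - l) \<bullet> b)"
    by (simp add: prod_Basis)
qed simp

lemma integral_powr_Ioc:
  assumes "0 < \<alpha>" "\<alpha> \<le> \<beta>" "e \<noteq> (0::real)"
  shows "(LINT r|lborel. indicator {\<alpha><..\<beta>} r * r powr (e - 1)) = (\<beta> powr e - \<alpha> powr e) / e"
proof -
  have "(LINT r|lborel. indicator {\<alpha><..\<beta>} r * r powr (e - 1)) =
      (LINT r|lborel. r powr (e - 1) * indicator {\<alpha>..\<beta>} r)"
    by (rule integral_cong_AE) (use AE_lborel_singleton[of \<alpha>] in \<open>auto simp: indicator_def\<close>)
  also have "\<dots> = \<beta> powr e / e - \<alpha> powr e / e"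
  proof (rule integral_FTC_Icc_real[OF assms(2)])
    fix x assume "\<alpha> \<le> x"
    then have "x > 0" using assms by simp
    then show "((\<lambda>r. r powr e / e) has_real_derivative x powr (e - 1)) (at x)"
      using assms(3) by (auto intro!: derivative_eq_intros simp: powr_diff)
    show "isCont (\<lambda>x. x powr (e - 1)) x"
      using \<open>x > 0\<close> by (intro continuous_intros) auto
  qed
  finally show ?thesis
    by (simp add: diff_divide_distrib)
qed

section \<open>Haar measure and dilations in exponential coordinates\<close>

context homogeneous_lie_group
begin

lemma space_haar [simp]: "space (haar G) = UNIV"
  by (simp add: haar_def)

lemma sets_haar [simp, measurable_cong]: "sets (haar G) = sets borel"
  by (simp add: haar_def)

lemma measurable_Exp [measurable]: "Exp \<in> borel_measurable borel"
  by (rule borel_measurable_continuous_onI[OF continuous_Exp])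

lemma haar_eq: "haar G = distr lborel borel Exp"
  by (simp add: haar_def Exp_def[abs_def])

lemma coords_one: "coords G \<one>\<^bsub>G\<^esub> = 0"
  using coords_Exp[of 0] by (simp add: Exp_0)

lemma Exp_eq_one: "Exp a = \<one>\<^bsub>G\<^esub> \<longleftrightarrow> a = 0"
  using coords_Exp[of a] coords_one Exp_0 by metis

lemma coords_dilation: "r > 0 \<Longrightarrow> coords G (dilation G r h) = dil r (coords G h)"
  using dilation_Exp[of r "coords G h"] by simp

text \<open>As all weights are at least 1, \<open>r powr weight G j\<close> lies below
  \<open>r\<close> for \<open>r \<le> 1\<close> and above it for \<open>r \<ge> 1\<close>. Together
  the two bounds bracket the crossing of the unit sphere in the next lemma.\<close>

lemma norm_dil_le: "0 < r \<Longrightarrow> r \<le> 1 \<Longrightarrow> norm (dil r a) \<le> r * norm a"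
  and norm_dil_ge: "1 \<le> r \<Longrightarrow> r * norm a \<le> norm (dil r a)"
proof -
  assume r: "0 < r" "r \<le> 1"
  have "norm (dil r a) \<le> norm (r *\<^sub>R a)"
  proof (rule norm_le_componentwise_cart)
    fix j
    have "r powr weight G j \<le> r powr 1"
      using r weight_ge_1[of j] by (intro powr_mono') auto
    then show "norm (dil r a $ j) \<le> norm ((r *\<^sub>R a) $ j)"
      using r by (simp add: dil_def abs_mult mult_right_mono)
  qed
  then show "norm (dil r a) \<le> r * norm a"
    using r by simp
next
  assume r: "1 \<le> r"
  have "norm (r *\<^sub>R a) \<le> norm (dil r a)"
  proof (rule norm_le_componentwise_cart)
    fix j
    have "r powr 1 \<le> r powr weight G j"
      using r weight_ge_1[of j] by (intro powr_mono) auto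
    then show "norm ((r *\<^sub>R a) $ j) \<le> norm (dil r a $ j)"
      using r by (simp add: dil_def abs_mult mult_right_mono)
  qed
  then show "r * norm a \<le> norm (dil r a)"
    using r by simp
qed

lemma dil_to_sphere:
  assumes "a \<noteq> 0"
  obtains r where "r > 0" "norm (dil r a) = 1"
proof -
  \<comment> \<open>With \<open>1 / norm a\<close> clipped at 1 from above or from below, the two
    bounds put \<open>norm (dil r a)\<close> on either side of 1, and the intermediate value theorem
    applies. The sphere is the Euclidean one, not that of a homogeneous norm.\<close>
  define lo hi where "lo = min 1 (1 / norm a)" and "hi = max 1 (1 / norm a)"
  have pos: "norm a > 0" using assms by simp
  have lo: "0 < lo" "lo \<le> hi"
    using pos by (auto simp: lo_def hi_def)
  have "norm (dil lo a) \<le> lo * norm a"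
    using lo(1) by (intro norm_dil_le) (auto simp: lo_def)
  also have "\<dots> \<le> 1 / norm a * norm a"
    by (intro mult_right_mono) (auto simp: lo_def)
  finally have "norm (dil lo a) \<le> 1"
    using pos by simp
  moreover have "1 \<le> norm (dil hi a)"
  proof -
    have "1 / norm a * norm a \<le> hi * norm a"
      by (intro mult_right_mono) (auto simp: hi_def)
    also have "\<dots> \<le> norm (dil hi a)"
      by (intro norm_dil_ge) (auto simp: hi_def)
    finally show ?thesis using pos by simp
  qed
  moreover have "continuous_on {lo..hi} (\<lambda>r. norm (dil r a))"
    unfolding dil_def using lo(1) by (intro continuous_intros) auto
  ultimately obtain r where "lo \<le> r" "norm (dil r a) = 1"
    using IVT'[of "\<lambda>r. norm (dil r a)" lo 1 hi] lo(2) by blast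
  moreover from this(1) lo(1) have "r > 0" by linarith
  ultimately show ?thesis
    using that by blast
qed

end

section \<open>The homogeneous norm compared with the coordinates\<close>

locale homogeneous_norm_group = homogeneous_lie_group G
  for G :: "('g::{t2_space,second_countable_topology}, 'n::finite) hdata" +
  fixes N :: "'g \<Rightarrow> real"
  assumes homogeneous_norm: "homogeneous_norm G N"
begin

lemma continuous_N: "continuous_on UNIV N" and N_nonneg [simp]: "0 \<le> N g"
  and N_eq_0: "N g = 0 \<longleftrightarrow> g = \<one>\<^bsub>G\<^esub>" and N_inv: "N (inv\<^bsub>G\<^esub> g) = N g"
  and N_dilation: "r > 0 \<Longrightarrow> N (dilation G r g) = r * N g"
  using homogeneous_norm by (auto simp: homogeneous_norm_def)

lemma measurable_N [measurable]: "N \<in> borel_measurable borel"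
  by (rule borel_measurable_continuous_onI[OF continuous_N])

text \<open>Homogeneity reduces the bound to the Euclidean unit sphere, where \<open>N\<close> has a
  positive minimum \<open>c\<close> by compactness. The dilation with parameter \<open>r\<close>
  that takes \<open>coords G h\<close> to this sphere satisfies \<open>c \<le> r * N h\<close>,
  while each dilated coordinate is at most 1 in absolute value. This gives
  \<open>C = 1 / c\<close>.\<close>

lemma coords_bound:
  obtains C where "C > 0" "\<And>h j. \<bar>coords G h $ j\<bar> \<le> (C * N h) powr weight G j"
proof -
  have "continuous_on (sphere 0 1) (\<lambda>a. N (Exp a))"
    by (rule continuous_on_compose2[OF continuous_N continuous_on_subset[OF continuous_Exp]]) auto
  moreover have "axis (undefined :: 'n) 1 \<in> sphere (0 :: real ^ 'n) 1"
    by (simp add: norm_axis_1)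
  ultimately obtain b where b: "b \<in> sphere 0 1" "\<And>a. a \<in> sphere 0 1 \<Longrightarrow> N (Exp b) \<le> N (Exp a)"
    using continuous_attains_inf[OF compact_sphere, of "0 :: real ^ 'n" 1 "\<lambda>a. N (Exp a)"] by blast
  define c where "c = N (Exp b)"
  have "b \<noteq> 0" using b(1) by auto
  then have c: "c > 0"
    unfolding c_def using N_eq_0[of "Exp b"] N_nonneg[of "Exp b"] Exp_eq_one[of b] by linarith
  have bound: "\<bar>coords G h $ j\<bar> \<le> (1 / c * N h) powr weight G j" for h j
  proof (cases "coords G h = 0")
    case False
    then obtain r where r: "r > 0" "norm (dil r (coords G h)) = 1"
      using dil_to_sphere by blast
    have "c \<le> N (dilation G r h)"
      using b(2)[of "dil r (coords G h)"] r dilation_Exp[of r "coords G h"] by (simp add: c_def)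
    then have le: "1 / r \<le> 1 / c * N h"
      using r c N_dilation[OF r(1)] by (simp add: field_simps)
    have "\<bar>dil r (coords G h) $ j\<bar> \<le> 1"
      using r(2) component_le_norm_cart by metis
    then have "\<bar>coords G h $ j\<bar> \<le> (1 / r) powr weight G j"
      using r(1) by (simp add: dil_def abs_mult powr_divide field_simps)
    also have "\<dots> \<le> (1 / c * N h) powr weight G j"
      using le r weight_ge_1[of j] by (intro powr_mono2) auto
    finally show ?thesis .
  qed simp
  show ?thesis
    using that[of "1 / c", OF _ bound] c by simp
qed

text \<open>The coordinate bound makes \<open>N\<close> proper. The finite measure of balls and the
  uniform bounds on third derivatives both rest on this.\<close>

lemma compact_sublevel:
  shows "compact {a. N (Exp a) \<le> R}" and "compact {h. N h \<le> R}"
proof -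
  obtain C where C: "C > 0" "\<And>h j. \<bar>coords G h $ j\<bar> \<le> (C * N h) powr weight G j"
    using coords_bound by blast
  have "norm a \<le> (\<Sum>j\<in>UNIV. (C * R) powr weight G j)" if "N (Exp a) \<le> R" for a
  proof -
    have "norm a \<le> (\<Sum>j\<in>UNIV. \<bar>a $ j\<bar>)" by (rule norm_le_l1_cart)
    also have "\<dots> \<le> (\<Sum>j\<in>UNIV. (C * R) powr weight G j)"
    proof (rule sum_mono)
      fix j
      have "(C * N (Exp a)) powr weight G j \<le> (C * R) powr weight G j"
        using that C(1) weight_ge_1[of j] by (intro powr_mono2) auto
      then show "\<bar>a $ j\<bar> \<le> (C * R) powr weight G j"
        using C(2)[of "Exp a" j] by simp
    qed
    finally show ?thesis .
  qed
  then have "bounded {a. N (Exp a) \<le> R}"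
    by (auto simp: bounded_iff)
  moreover have "closed {a. N (Exp a) \<le> R}"
    using continuous_on_compose2[OF continuous_N continuous_Exp]
    by (intro closed_Collect_le) (auto intro: continuous_intros)
  ultimately show c: "compact {a. N (Exp a) \<le> R}"
    by (simp add: compact_eq_bounded_closed)
  have "{h. N h \<le> R} = Exp ` {a. N (Exp a) \<le> R}"
    by (auto intro: image_eqI[where x = "coords G _"])
  then show "compact {h. N h \<le> R}"
    using compact_continuous_image[OF continuous_on_subset[OF continuous_Exp] c] by simp
qed

lemma emeasure_sublevel_finite: "emeasure (haar G) {h. N h \<le> R} < \<infinity>"
proof -
  have "emeasure (haar G) {h. N h \<le> R} = emeasure lborel {a. N (Exp a) \<le> R}"
    by (subst haar_eq, subst emeasure_distr) (auto simp: vimage_def)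
  then show ?thesis
    using emeasure_bounded_finite[OF compact_imp_bounded[OF compact_sublevel(1)]] by simp
qed

end

section \<open>Polar coordinates\<close>

locale polar_group = homogeneous_norm_group G N
  for G :: "('g::{t2_space,second_countable_topology}, 'n::finite) hdata" and N +
  fixes \<sigma> :: "'g measure"
  assumes sphere_measure: "sphere_measure G N \<sigma>"
begin

lemma space_sigma: "space \<sigma> = {h. N h = 1}"
  using sphere_measure sets_eq_imp_space_eq[of \<sigma> "restrict_space borel {h. N h = 1}"]
  by (simp add: sphere_measure_def radon_measure_on_def space_restrict_space)

lemma polar:
  assumes "integrable (haar G) u"
  shows "(LINT h|haar G. u h) =
    (LINT r:{0<..}|lborel. (LINT h|\<sigma>. u (dilation G r h) * r powr (hom_dim G - 1)))"
  using sphere_measure assms unfolding sphere_measure_def by blast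

text \<open>At the dilate by \<open>r\<close> of a point of the unit sphere, the quotient is
  \<open>r powr (\<kappa> - \<rho>)\<close> times the value of \<open>q\<close> at that point, so
  the polar formula separates the variables. With the Jacobian \<open>r powr (hom_dim G - 1)\<close>
  the radial factor is \<open>r powr (e - 1)\<close>, and \<open>e \<noteq> 0\<close> excludes a
  logarithm.\<close>

lemma annulus:
  fixes q :: "'g \<Rightarrow> real"
  assumes q: "continuous_on UNIV q"
    and hom: "\<And>r h. r > 0 \<Longrightarrow> q (dilation G r h) = r powr \<kappa> * q h"
    and ab: "0 < \<alpha>" "\<alpha> \<le> \<beta>" and e: "\<kappa> - \<rho> + hom_dim G = e" "e \<noteq> 0"
  shows "integrable (haar G) (\<lambda>h. indicator {\<alpha><..\<beta>} (N h) * (q h / N h powr \<rho>))"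
    and "(LINT h|haar G. indicator {\<alpha><..\<beta>} (N h) * (q h / N h powr \<rho>)) =
      (LINT h|\<sigma>. q h) * ((\<beta> powr e - \<alpha> powr e) / e)"
proof -
  let ?f = "\<lambda>h. indicator {\<alpha><..\<beta>} (N h) * (q h / N h powr \<rho>)"
  let ?K = "{h. \<alpha> \<le> N h} \<inter> {h. N h \<le> \<beta>}"
  have [measurable]: "q \<in> borel_measurable borel"
    by (rule borel_measurable_continuous_onI[OF q])
  have "closed {h. \<alpha> \<le> N h}"
    by (intro closed_Collect_le continuous_N continuous_on_const)
  then have "compact ?K"
    using compact_sublevel(2) by (rule closed_Int_compact)
  moreover have "continuous_on ?K (\<lambda>h. q h / N h powr \<rho>)"
    using ab(1) by (intro continuous_intros continuous_on_subset[OF q] continuous_on_subset[OF continuous_N]) auto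
  ultimately have "bounded ((\<lambda>h. q h / N h powr \<rho>) ` ?K)"
    using compact_continuous_image compact_imp_bounded by blast
  then obtain B where B: "\<And>h. h \<in> ?K \<Longrightarrow> \<bar>q h / N h powr \<rho>\<bar> \<le> B"
    unfolding bounded_iff real_norm_def by blast
  show int: "integrable (haar G) ?f"
  \<comment> \<open>The integrand is 0 off the annulus, and \<open>B\<close> itself may be negative
    when \<open>?K\<close> is empty; hence \<open>max B 0\<close>.\<close>
  proof (rule integrableI_bounded_set[of "{h. N h \<le> \<beta>}" _ _ "max B 0"])
    show "AE h in haar G. h \<in> {h. N h \<le> \<beta>} \<longrightarrow> norm (?f h) \<le> max B 0"
    proof (rule AE_I2, rule impI)
      fix h
      show "norm (?f h) \<le> max B 0"
        using B[of h] by (cases "N h \<in> {\<alpha><..\<beta>}") auto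
    qed
  qed (auto simp: emeasure_sublevel_finite[simplified])
  have inner: "(LINT h|\<sigma>. ?f (dilation G r h) * r powr (hom_dim G - 1)) =
      indicator {\<alpha><..\<beta>} r * r powr (e - 1) * (LINT h|\<sigma>. q h)" if "r > 0" for r
  proof -
    have "(LINT h|\<sigma>. ?f (dilation G r h) * r powr (hom_dim G - 1)) =
        (LINT h|\<sigma>. (indicator {\<alpha><..\<beta>} r * r powr (e - 1)) * q h)"
    proof (rule Bochner_Integration.integral_cong[OF refl])
      fix h assume "h \<in> space \<sigma>"
      then have "N (dilation G r h) = r"
        using N_dilation[OF that, of h] by (simp add: space_sigma)
      then have "?f (dilation G r h) * r powr (hom_dim G - 1) =
          indicator {\<alpha><..\<beta>} r * q h * (r powr \<kappa> / r powr \<rho> * r powr (hom_dim G - 1))"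
        using hom[OF that, of h] by simp
      also have "r powr \<kappa> / r powr \<rho> * r powr (hom_dim G - 1) = r powr (e - 1)"
        unfolding e(1)[symmetric] using that
        by (simp add: powr_diff[symmetric] powr_add[symmetric] algebra_simps)
      finally show "?f (dilation G r h) * r powr (hom_dim G - 1) =
          (indicator {\<alpha><..\<beta>} r * r powr (e - 1)) * q h"
        by simp
    qed
    then show ?thesis by simp
  qed
  have "(LINT h|haar G. ?f h) =
      (LINT r|lborel. (LINT h|\<sigma>. q h) * (indicator {\<alpha><..\<beta>} r * r powr (e - 1)))"
    unfolding polar[OF int] set_lebesgue_integral_def
  proof (rule Bochner_Integration.integral_cong[OF refl])
    fix r :: real
    show "indicator {0<..} r *\<^sub>R (LINT h|\<sigma>. ?f (dilation G r h) * r powr (hom_dim G - 1)) =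
        (LINT h|\<sigma>. q h) * (indicator {\<alpha><..\<beta>} r * r powr (e - 1))"
      using inner[of r] ab(1) by (cases "r > 0") (auto simp: indicator_def)
  qed
  also have "\<dots> = (LINT h|\<sigma>. q h) * ((\<beta> powr e - \<alpha> powr e) / e)"
    unfolding integral_powr_Ioc[OF ab e(2), symmetric] by simp
  finally show "(LINT h|haar G. ?f h) = (LINT h|\<sigma>. q h) * ((\<beta> powr e - \<alpha> powr e) / e)" .
qed

text \<open>At \<open>h = e\<close> the integrand is \<open>0\<close>, since \<open>0 powr \<rho> = 0\<close> and division by zero yields zero.\<close>

lemma ball_integral:
  fixes q :: "'g \<Rightarrow> real"
  assumes q: "continuous_on UNIV q" "\<And>h. 0 \<le> q h"
    and hom: "\<And>r h. r > 0 \<Longrightarrow> q (dilation G r h) = r powr \<kappa> * q h"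
    and R: "0 < R" and e: "\<kappa> - \<rho> + hom_dim G = e" "e > 0"
  shows "integrable (haar G) (\<lambda>h. indicator {..R} (N h) * (q h / N h powr \<rho>))"
    and "(LINT h|haar G. indicator {..R} (N h) * (q h / N h powr \<rho>)) =
      (LINT h|\<sigma>. q h) * (R powr e / e)"
proof -
  \<comment> \<open>The inner radii decrease to 0, so these annuli exhaust the punctured ball; since
    \<open>e > 0\<close>, the inner boundary term vanishes in the limit.\<close>
  define f where "f i h = indicator {R / real (Suc i)<..R} (N h) * (q h / N h powr \<rho>)" for i h
  let ?I = "LINT h|\<sigma>. q h"
  have [measurable]: "q \<in> borel_measurable borel"
    by (rule borel_measurable_continuous_onI[OF q(1)])
  have le: "0 < R / real (Suc i)" "R / real (Suc i) \<le> R" for i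
    using R by (auto simp: field_simps)
  have null: "(\<lambda>i. R / real (Suc i)) \<longlonglongrightarrow> 0"
    by (rule LIMSEQ_Suc[OF lim_const_over_n])
  have int: "integrable (haar G) (f i)" and
    integral: "(LINT h|haar G. f i h) = ?I * ((R powr e - (R / real (Suc i)) powr e) / e)" for i
    unfolding f_def using annulus[OF q(1) hom le[of i] e(1)] e(2) by auto
  have mono: "AE h in haar G. mono (\<lambda>i. f i h)"
  proof (rule AE_I2, rule monoI)
    fix h and i j :: nat assume "i \<le> j"
    then have "R / real (Suc j) \<le> R / real (Suc i)"
      using R by (intro divide_left_mono) auto
    then show "f i h \<le> f j h"
      unfolding f_def using q(2)[of h] by (intro mult_right_mono) (auto simp: indicator_def)
  qed
  have nonneg: "AE h in haar G. 0 \<le> f i h" for i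
    by (rule AE_I2) (simp add: f_def q(2))
  have lim: "AE h in haar G. (\<lambda>i. f i h) \<longlonglongrightarrow> indicator {..R} (N h) * (q h / N h powr \<rho>)"
  proof (rule AE_I2)
    fix h
    show "(\<lambda>i. f i h) \<longlonglongrightarrow> indicator {..R} (N h) * (q h / N h powr \<rho>)"
    proof (cases "N h = 0")
      case False
      then have "0 < N h" using N_nonneg[of h] by linarith
      then have "\<forall>\<^sub>F i in sequentially. R / real (Suc i) < N h"
        using order_tendstoD(2)[OF null] by blast
      then have "\<forall>\<^sub>F i in sequentially. f i h = indicator {..R} (N h) * (q h / N h powr \<rho>)"
        by eventually_elim (auto simp: f_def indicator_def)
      then show ?thesis by (rule tendsto_eventually)
    qed (simp add: f_def)
  qed
  have integral_lim: "(\<lambda>i. LINT h|haar G. f i h) \<longlonglongrightarrow> ?I * (R powr e / e)"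
  proof -
    have "(\<lambda>i. (R / real (Suc i)) powr e) \<longlonglongrightarrow> 0"
      by (rule tendsto_zero_powrI[OF null tendsto_const _ e(2)]) (use R in auto)
    then have "(\<lambda>i. ?I * ((R powr e - (R / real (Suc i)) powr e) / e)) \<longlonglongrightarrow> ?I * ((R powr e - 0) / e)"
      using e(2) by (intro tendsto_intros) auto
    then show ?thesis by (simp add: integral)
  qed
  have meas: "(\<lambda>h. indicator {..R} (N h) * (q h / N h powr \<rho>)) \<in> borel_measurable (haar G)"
    by measurable
  show "integrable (haar G) (\<lambda>h. indicator {..R} (N h) * (q h / N h powr \<rho>))"
    and "(LINT h|haar G. indicator {..R} (N h) * (q h / N h powr \<rho>)) = ?I * (R powr e / e)"
    using integral_monotone_convergence_nonneg[OF int mono nonneg lim integral_lim meas] by auto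
qed

text \<open>Here the outer radius grows and \<open>e < 0\<close> makes the outer boundary term
  vanish. What remains is the inner term with its minus sign, which accounts for the denominator
  \<open>- e\<close>.\<close>

lemma complement_integral:
  fixes q :: "'g \<Rightarrow> real"
  assumes q: "continuous_on UNIV q" "\<And>h. 0 \<le> q h"
    and hom: "\<And>r h. r > 0 \<Longrightarrow> q (dilation G r h) = r powr \<kappa> * q h"
    and R: "0 < R" and e: "\<kappa> - \<rho> + hom_dim G = e" "e < 0"
  shows "integrable (haar G) (\<lambda>h. indicator {R<..} (N h) * (q h / N h powr \<rho>))"
    and "(LINT h|haar G. indicator {R<..} (N h) * (q h / N h powr \<rho>)) =
      (LINT h|\<sigma>. q h) * (R powr e / - e)"
proof -
  define f where "f i h = indicator {R<..R * real (Suc i)} (N h) * (q h / N h powr \<rho>)" for i h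
  let ?I = "LINT h|\<sigma>. q h"
  have [measurable]: "q \<in> borel_measurable borel"
    by (rule borel_measurable_continuous_onI[OF q(1)])
  have le: "R \<le> R * real (Suc i)" for i
    using R by (auto simp: field_simps)
  have top: "filterlim (\<lambda>i. R * real (Suc i)) at_top sequentially"
    using R filterlim_tendsto_pos_mult_at_top[OF tendsto_const R
        filterlim_compose[OF filterlim_real_sequentially filterlim_Suc]] by simp
  have int: "integrable (haar G) (f i)" and
    integral: "(LINT h|haar G. f i h) = ?I * (((R * real (Suc i)) powr e - R powr e) / e)" for i
    unfolding f_def using annulus[OF q(1) hom R le[of i] e(1)] e(2) by auto
  have mono: "AE h in haar G. mono (\<lambda>i. f i h)"
  proof (rule AE_I2, rule monoI)
    fix h and i j :: nat assume "i \<le> j"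
    then have "R * real (Suc i) \<le> R * real (Suc j)"
      using R by (intro mult_left_mono) auto
    then show "f i h \<le> f j h"
      unfolding f_def using q(2)[of h] by (intro mult_right_mono) (auto simp: indicator_def)
  qed
  have nonneg: "AE h in haar G. 0 \<le> f i h" for i
    by (rule AE_I2) (simp add: f_def q(2))
  have lim: "AE h in haar G. (\<lambda>i. f i h) \<longlonglongrightarrow> indicator {R<..} (N h) * (q h / N h powr \<rho>)"
  proof (rule AE_I2)
    fix h
    have "\<forall>\<^sub>F i in sequentially. N h \<le> R * real (Suc i)"
      using top by (simp add: filterlim_at_top)
    then have "\<forall>\<^sub>F i in sequentially. f i h = indicator {R<..} (N h) * (q h / N h powr \<rho>)"
      by eventually_elim (auto simp: f_def indicator_def)
    then show "(\<lambda>i. f i h) \<longlonglongrightarrow> indicator {R<..} (N h) * (q h / N h powr \<rho>)"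
      by (rule tendsto_eventually)
  qed
  have integral_lim: "(\<lambda>i. LINT h|haar G. f i h) \<longlonglongrightarrow> ?I * (R powr e / - e)"
  proof -
    have "(\<lambda>i. (R * real (Suc i)) powr e) \<longlonglongrightarrow> 0"
      by (rule tendsto_neg_powr[OF e(2) top])
    then have "(\<lambda>i. ?I * (((R * real (Suc i)) powr e - R powr e) / e)) \<longlonglongrightarrow> ?I * ((0 - R powr e) / e)"
      using e(2) by (intro tendsto_intros) auto
    then show ?thesis by (simp add: integral)
  qed
  have meas: "(\<lambda>h. indicator {R<..} (N h) * (q h / N h powr \<rho>)) \<in> borel_measurable (haar G)"
    by measurable
  show "integrable (haar G) (\<lambda>h. indicator {R<..} (N h) * (q h / N h powr \<rho>))"
    and "(LINT h|haar G. indicator {R<..} (N h) * (q h / N h powr \<rho>)) = ?I * (R powr e / - e)"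
    using integral_monotone_convergence_nonneg[OF int mono nonneg lim integral_lim meas] by auto
qed

text \<open>It makes the divisors \<open>sigma_Q\<close> and \<open>tau_m\<close> positive.
  Positivity is read off from an annulus containing \<open>h0\<close>: the integrand is
  non-negative, and it is positive on a non-empty open set, whose image in coordinates is not a null
  set.\<close>

lemma sphere_integral_pos:
  fixes q :: "'g \<Rightarrow> real"
  assumes q: "continuous_on UNIV q" "\<And>h. 0 \<le> q h"
    and hom: "\<And>r h. r > 0 \<Longrightarrow> q (dilation G r h) = r powr \<kappa> * q h"
    and h0: "q h0 > 0" "h0 \<noteq> \<one>\<^bsub>G\<^esub>"
  shows "(LINT h|\<sigma>. q h) > 0"
proof -
  define \<alpha> \<beta> where "\<alpha> = N h0 / 2" and "\<beta> = 2 * N h0"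
  have N0: "0 < N h0"
    using N_eq_0[of h0] h0(2) N_nonneg[of h0] by linarith
  then have ab: "0 < \<alpha>" "\<alpha> \<le> \<beta>" "\<alpha> < N h0" "N h0 < \<beta>" "\<alpha> < \<beta>"
    by (auto simp: \<alpha>_def \<beta>_def)
  \<comment> \<open>This exponent makes \<open>e = 1\<close>, so that the radial factor is simply
    \<open>\<beta> - \<alpha>\<close>.\<close>
  define \<rho> where "\<rho> = \<kappa> + hom_dim G - 1"
  let ?f = "\<lambda>h. indicator {\<alpha><..\<beta>} (N h) * (q h / N h powr \<rho>)"
  have [measurable]: "q \<in> borel_measurable borel"
    by (rule borel_measurable_continuous_onI[OF q(1)])
  have e: "\<kappa> - \<rho> + hom_dim G = 1"
    by (simp add: \<rho>_def)
  note ann = annulus[OF q(1) hom ab(1,2) e, simplified]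
  have f_nonneg: "0 \<le> ?f h" for h
    using q(2) by simp
  have "(LINT h|haar G. ?f h) \<noteq> 0"
  proof
    assume "(LINT h|haar G. ?f h) = 0"
    then have "AE h in haar G. ?f h = 0"
      using integral_nonneg_eq_0_iff_AE[OF ann(1)] f_nonneg by simp
    then have ae: "AE a in lborel. ?f (Exp a) = 0"
      by (subst (asm) haar_eq, subst (asm) AE_distr_iff) auto
    let ?S = "{a. \<alpha> < N (Exp a)} \<inter> {a. N (Exp a) < \<beta>} \<inter> {a. 0 < q (Exp a)}"
    have "open ?S"
      using continuous_on_compose2[OF continuous_N continuous_Exp]
        continuous_on_compose2[OF q(1) continuous_Exp]
      by (intro open_Int open_Collect_less) (auto intro: continuous_on_const)
    moreover have "coords G h0 \<in> ?S"
      using h0 ab by simp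
    ultimately have "\<not> negligible ?S"
      using open_not_negligible by blast
    moreover have ae_S: "AE a in lborel. a \<notin> ?S"
      using ae by eventually_elim (use ab(1) in \<open>auto simp: indicator_def\<close>)
    have "?S \<in> null_sets lborel"
      using ae_S \<open>open ?S\<close> by (intro iffD2[OF AE_iff_null_sets]) auto
    then have "negligible ?S"
      unfolding negligible_iff_null_sets by (rule null_sets_completionI)
    ultimately show False by blast
  qed
  moreover have "(LINT h|haar G. ?f h) \<ge> 0"
    using f_nonneg by (rule Bochner_Integration.integral_nonneg)
  ultimately have "0 < (LINT h|haar G. ?f h)"
    by linarith
  then have "0 < (LINT h|\<sigma>. q h) * (\<beta> - \<alpha>)"
    using ann(2) ab by simp
  then show ?thesis
    using ab(5) by (simp add: zero_less_mult_iff)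
qed

end

section \<open>Order of vanishing at the identity\<close>

context homogeneous_norm_group
begin

lemma measurable_coords_nth [measurable]: "(\<lambda>h. coords G h $ j) \<in> borel_measurable borel"
  by (intro borel_measurable_continuous_onI continuous_intros continuous_coords)

lemma continuous_inv: "continuous_on UNIV (\<lambda>h. inv\<^bsub>G\<^esub> h)"
  using lie_group by (simp add: lie_group_def smooth_map_on_def)

lemma integral_haar_signed_involution:
  fixes f :: "'g \<Rightarrow> real"
  assumes inv: "\<And>j. \<pi> (\<pi> j) = j" and sgn: "\<And>j. \<epsilon> j = 1 \<or> \<epsilon> j = - 1"
    and f [measurable]: "f \<in> borel_measurable borel"
  shows "(LINT h|haar G. f h) = (LINT h|haar G. f (Exp (\<chi> j. \<epsilon> j * coords G h $ \<pi> j)))"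
proof -
  let ?T = "\<lambda>a :: real ^ 'n. \<chi> j. \<epsilon> j * a $ \<pi> j"
  have [measurable]: "?T \<in> borel_measurable borel" "(\<lambda>h. ?T (coords G h)) \<in> borel_measurable borel"
    by (intro borel_measurable_continuous_onI continuous_intros continuous_coords)+
  have "(LINT h|haar G. f h) = (LINT a|lborel. f (Exp a))"
    unfolding haar_eq by (subst integral_distr) auto
  also have "\<dots> = (LINT a|distr lborel borel ?T. f (Exp a))"
    by (simp only: distr_lborel_signed_involution[OF inv sgn])
  also have "\<dots> = (LINT a|lborel. f (Exp (?T a)))"
    by (subst integral_distr) auto
  also have "\<dots> = (LINT h|haar G. f (Exp (?T (coords G h))))"
    unfolding haar_eq by (subst integral_distr) auto
  finally show ?thesis .
qed

text \<open>Big-O of the \<open>t\<close>-th power of the norm, with a constant valid on the whole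
  ball rather than near the identity, because the same \<open>R\<close> later separates the two
  parts of the integral. As \<open>0 powr t = 0\<close>, it forces \<open>p\<close> to vanish at the
  identity when \<open>R \<ge> 0\<close>.\<close>

definition ball_order :: "real \<Rightarrow> real \<Rightarrow> ('g \<Rightarrow> real) \<Rightarrow> bool" where
  "ball_order R t p \<longleftrightarrow> (\<exists>K\<ge>0. \<forall>h. N h \<le> R \<longrightarrow> \<bar>p h\<bar> \<le> K * N h powr t)"

lemma ball_orderI: "0 \<le> K \<Longrightarrow> (\<And>h. N h \<le> R \<Longrightarrow> \<bar>p h\<bar> \<le> K * N h powr t) \<Longrightarrow> ball_order R t p"
  unfolding ball_order_def by blast

lemma ball_order_dominated:
  assumes "ball_order R t p" "\<And>h. N h \<le> R \<Longrightarrow> \<bar>q h\<bar> \<le> \<bar>p h\<bar>"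
  shows "ball_order R t q"
  using assms unfolding ball_order_def by (meson order_trans)

lemma ball_order_add:
  assumes "ball_order R t p" "ball_order R t q"
  shows "ball_order R t (\<lambda>h. p h + q h)"
proof -
  obtain K L where "0 \<le> K" "0 \<le> L" "\<And>h. N h \<le> R \<Longrightarrow> \<bar>p h\<bar> \<le> K * N h powr t"
    "\<And>h. N h \<le> R \<Longrightarrow> \<bar>q h\<bar> \<le> L * N h powr t"
    using assms unfolding ball_order_def by metis
  then show ?thesis
    by (intro ball_orderI[of "K + L"]) (auto simp: distrib_right intro: order_trans[OF abs_triangle_ineq add_mono])
qed

lemma ball_order_mult_const:
  assumes "ball_order R t p"
  shows "ball_order R t (\<lambda>h. p h * c)"
proof -
  obtain K where K: "0 \<le> K" "\<And>h. N h \<le> R \<Longrightarrow> \<bar>p h\<bar> \<le> K * N h powr t"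
    using assms unfolding ball_order_def by metis
  show ?thesis
  proof (rule ball_orderI[of "K * \<bar>c\<bar>"])
    show "\<bar>p h * c\<bar> \<le> K * \<bar>c\<bar> * N h powr t" if "N h \<le> R" for h
      using mult_right_mono[OF K(2)[OF that], of "\<bar>c\<bar>"] by (simp add: abs_mult mult_ac)
  qed (use K in simp)
qed

lemma ball_order_sum:
  assumes "\<And>i. i \<in> I \<Longrightarrow> ball_order R t (p i)"
  shows "ball_order R t (\<lambda>h. \<Sum>i\<in>I. p i h)"
proof -
  have "ball_order R t (\<lambda>h. 0)"
    by (rule ball_orderI[of 0]) auto
  with assms show ?thesis
    by (induction I rule: infinite_finite_induct) (auto intro: ball_order_add)
qed

lemma ball_order_mono:
  assumes "ball_order R t' p" "t \<le> t'" "0 < R"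
  shows "ball_order R t p"
proof -
  obtain K where K: "0 \<le> K" "\<And>h. N h \<le> R \<Longrightarrow> \<bar>p h\<bar> \<le> K * N h powr t'"
    using assms(1) unfolding ball_order_def by metis
  show ?thesis
  proof (rule ball_orderI[of "K * R powr (t' - t)"])
    fix h assume h: "N h \<le> R"
    have "N h powr t' = N h powr (t' - t) * N h powr t"
      by (simp flip: powr_add)
    also have "\<dots> \<le> R powr (t' - t) * N h powr t"
      using h assms(2) by (intro mult_right_mono powr_mono2) auto
    finally show "\<bar>p h\<bar> \<le> K * R powr (t' - t) * N h powr t"
      using K(2)[OF h] K(1) by (metis (no_types, lifting) mult.assoc mult_left_mono order_trans)
  qed (use K(1) in simp)
qed

lemma ball_order_coords: "ball_order R (weight G j) (\<lambda>h. coords G h $ j)"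
proof -
  obtain C where C: "C > 0" "\<And>h j. \<bar>coords G h $ j\<bar> \<le> (C * N h) powr weight G j"
    using coords_bound by blast
  then show ?thesis
    by (intro ball_orderI[of "C powr weight G j"]) (auto simp: powr_mult)
qed

lemma ball_order_mult:
  assumes "ball_order R s p" "ball_order R t q"
  shows "ball_order R (s + t) (\<lambda>h. p h * q h)"
proof -
  obtain K L where K: "0 \<le> K" "0 \<le> L" "\<And>h. N h \<le> R \<Longrightarrow> \<bar>p h\<bar> \<le> K * N h powr s"
    "\<And>h. N h \<le> R \<Longrightarrow> \<bar>q h\<bar> \<le> L * N h powr t"
    using assms unfolding ball_order_def by metis
  show ?thesis
  proof (rule ball_orderI[of "K * L"])
    fix h assume h: "N h \<le> R"
    have "\<bar>p h\<bar> * \<bar>q h\<bar> \<le> (K * N h powr s) * (L * N h powr t)"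
      using K(1,2) K(3)[OF h] K(4)[OF h] by (intro mult_mono) auto
    then show "\<bar>p h * q h\<bar> \<le> K * L * N h powr (s + t)"
      by (simp add: abs_mult powr_add mult_ac)
  qed (use K in simp)
qed

text \<open>A nonzero value puts \<open>h\<close> into the translate of the compact support by the
  inverse of \<open>g\<close>, and \<open>N\<close> is bounded there. Taking \<open>max B 1\<close>
  makes the radius positive.\<close>

lemma compact_support_radius:
  assumes "u \<in> test_functions G"
  obtains R where "R > 0" "\<And>h. R < N h \<Longrightarrow> u (g \<odot> h) = 0"
proof -
  let ?K = "closure {x. u x \<noteq> 0}"
  have "continuous_on UNIV (\<lambda>x. N (inv\<^bsub>G\<^esub> g \<odot> x))"
    by (rule continuous_on_compose2[OF continuous_N continuous_mult]) auto
  then have "compact ((\<lambda>x. N (inv\<^bsub>G\<^esub> g \<odot> x)) ` ?K)"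
    using assms unfolding test_functions_def
    by (intro compact_continuous_image) (auto intro: continuous_on_subset)
  then have "bounded ((\<lambda>x. N (inv\<^bsub>G\<^esub> g \<odot> x)) ` ?K)"
    by (rule compact_imp_bounded)
  then obtain B where B: "\<And>x. x \<in> ?K \<Longrightarrow> N (inv\<^bsub>G\<^esub> g \<odot> x) \<le> B"
    unfolding bounded_iff by auto
  have "u (g \<odot> h) = 0" if "max B 1 < N h" for h
  proof (rule ccontr)
    assume "u (g \<odot> h) \<noteq> 0"
    then have "g \<odot> h \<in> ?K"
      by (intro subsetD[OF closure_subset]) simp
    moreover have "inv\<^bsub>G\<^esub> g \<odot> (g \<odot> h) = h"
      using group.is_monoid[OF group] group.l_inv[OF group] carrier
      by (metis UNIV_I assoc monoid.l_one)
    ultimately show False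
      using B[of "g \<odot> h"] that by simp
  qed
  then show ?thesis
    using that[of "max B 1"] by simp
qed

text \<open>The expansion contains all second-order terms. Those with an index outside the first
  layer are moved into the error, next to the third-order remainder.\<close>

lemma taylor_remainder:
  assumes u: "u \<in> smooth_functions G" and R: "R > 0"
  defines "F \<equiv> first_layer G"
  obtains t where "t > 2" "ball_order R t (\<lambda>h. 2 * u g - u (g \<odot> h) - u (g \<odot> inv\<^bsub>G\<^esub> h) +
    (\<Sum>i\<in>F. \<Sum>j\<in>F. coords G h $ i * coords G h $ j * basis_field G i (basis_field G j u) g))"
proof -
  let ?x = "\<lambda>h i. coords G h $ i"
  define D where "D i j = basis_field G i (basis_field G j u) g" for i j
  define D3 where "D3 i j k = basis_field G i (basis_field G j (basis_field G k u))" for i j k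
  define I where "I = UNIV - F \<times> F"
  \<comment> \<open>The smallest order among the discarded second-order terms, capped by 3, which
    every cubic term attains. The inserted 3 also keeps the set non-empty when all weights are
    1.\<close>
  define t where "t = Min (insert 3 ((\<lambda>(i, j). weight G i + weight G j) ` I))"
  have t_le: "t \<le> weight G i + weight G j" if "(i, j) \<in> I" for i j
    unfolding t_def using that by (intro Min_le) force+
  have "t \<le> 3"
    unfolding t_def by (intro Min_le) auto
  have t_le_3: "t \<le> weight G i + weight G j + weight G k" for i j k
    using \<open>t \<le> 3\<close> weight_ge_1[of i] weight_ge_1[of j] weight_ge_1[of k] by linarith
  have "2 < weight G i + weight G j" if "(i, j) \<in> I" for i j
  proof -
    have "weight G i \<noteq> 1 \<or> weight G j \<noteq> 1"
      using that by (auto simp: I_def F_def first_layer_def)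
    then show ?thesis
      using weight_ge_1[of i] weight_ge_1[of j] by linarith
  qed
  then have "t > 2"
    unfolding t_def by (subst Min_gr_iff) auto
  \<comment> \<open>The intermediate points of the Taylor formula lie on a straight segment through
    0 in coordinates. A Euclidean ball contains such a segment with its endpoints, so the third
    derivatives are bounded on a Euclidean ball around the sublevel set.\<close>
  obtain \<rho> where \<rho>: "\<And>a. N (Exp a) \<le> R \<Longrightarrow> norm a \<le> \<rho>"
    using compact_imp_bounded[OF compact_sublevel(1)[of R]] unfolding bounded_iff by auto
  have "\<exists>B. \<forall>b\<in>cball 0 \<rho>. \<bar>D3 i j k (g \<odot> Exp b)\<bar> \<le> B" for i j k
  proof -
    have "D3 i j k \<in> smooth_functions G"
      unfolding D3_def
      by (rule smooth_field[OF basis_field_in smooth_field[OF basis_field_in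
            smooth_field[OF basis_field_in u]]])
    then have "continuous_on UNIV (D3 i j k)"
      by (simp add: smooth_functions_iff)
    moreover have "continuous_on (cball 0 \<rho>) (\<lambda>b. g \<odot> Exp b)"
      by (rule continuous_on_compose2[OF continuous_mult continuous_on_subset[OF continuous_Exp]]) auto
    ultimately have "continuous_on (cball 0 \<rho>) (\<lambda>b. D3 i j k (g \<odot> Exp b))"
      by (rule continuous_on_compose2) auto
    then have "bounded ((\<lambda>b. D3 i j k (g \<odot> Exp b)) ` cball 0 \<rho>)"
      by (intro compact_imp_bounded compact_continuous_image) auto
    then show ?thesis
      unfolding bounded_iff by auto
  qed
  note bound = someI_ex[OF this]
  define B where "B i j k = (SOME B. \<forall>b\<in>cball 0 \<rho>. \<bar>D3 i j k (g \<odot> Exp b)\<bar> \<le> B)" for i j k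
  have B: "\<bar>D3 i j k (g \<odot> Exp b)\<bar> \<le> B i j k" if "norm b \<le> \<rho>" for i j k b
    using bound[of i j k] that unfolding B_def by simp
  define p where "p h = (\<Sum>i\<in>UNIV. \<Sum>j\<in>UNIV. \<Sum>k\<in>UNIV. \<bar>?x h i * ?x h j * ?x h k\<bar> * B i j k) +
    (\<Sum>(i, j)\<in>I. \<bar>?x h i * ?x h j\<bar> * \<bar>D i j\<bar>)" for h
  have ball_abs: "ball_order R t (\<lambda>h. \<bar>q h\<bar>)" if "ball_order R t q" for q t
    using that by (rule ball_order_dominated) simp
  have "ball_order R t p"
    unfolding p_def case_prod_beta
    by (intro ball_order_add ball_order_sum ball_order_mult_const ball_abs
        ball_order_mono[OF ball_order_mult[OF ball_order_coords ball_order_coords] _ R]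
        ball_order_mono[OF ball_order_mult[OF ball_order_mult[OF ball_order_coords ball_order_coords]
          ball_order_coords] _ R] t_le t_le_3) auto
  then have "ball_order R t (\<lambda>h. 2 * u g - u (g \<odot> h) - u (g \<odot> inv\<^bsub>G\<^esub> h) +
      (\<Sum>i\<in>F. \<Sum>j\<in>F. ?x h i * ?x h j * D i j))"
  proof (rule ball_order_dominated)
    fix h assume h: "N h \<le> R"
    define a where "a = coords G h"
    have Exp_a: "Exp a = h" by (simp add: a_def)
    then have a: "norm a \<le> \<rho>"
      using h \<rho> by simp
    let ?Y = "field_of G a"
    let ?c = "\<Sum>i\<in>UNIV. \<Sum>j\<in>UNIV. \<Sum>k\<in>UNIV. \<bar>?x h i * ?x h j * ?x h k\<bar> * B i j k"
    have Y3: "\<bar>?Y (?Y (?Y u)) (g \<odot> Exp (r *\<^sub>R a))\<bar> \<le> ?c" if "\<bar>r\<bar> \<le> 1" for r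
    proof -
      have "norm (r *\<^sub>R a) \<le> \<rho>"
        using a that mult_left_le_one_le[of "norm a" "\<bar>r\<bar>"] by simp
      then have "\<bar>D3 i j k (g \<odot> Exp (r *\<^sub>R a))\<bar> \<le> B i j k" for i j k
        by (rule B)
      then show ?thesis
        unfolding field_of_3[OF u] D3_def[symmetric] a_def
        by (intro order_trans[OF sum_abs] sum_mono) (simp add: abs_mult mult_left_mono)
    qed
    obtain t1 t2 where t12: "\<bar>t1\<bar> \<le> 1" "\<bar>t2\<bar> \<le> 1"
      "u (g \<odot> Exp a) + u (g \<odot> Exp (- a)) - 2 * u g =
        ?Y (?Y u) g + (?Y (?Y (?Y u)) (g \<odot> Exp (t1 *\<^sub>R a)) - ?Y (?Y (?Y u)) (g \<odot> Exp (t2 *\<^sub>R a))) / 6"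
      using Taylor_Exp[OF u] by blast
    have "?Y (?Y u) g = (\<Sum>(i, j)\<in>UNIV \<times> UNIV. ?x h i * ?x h j * D i j)"
      unfolding field_of_2[OF u] sum.cartesian_product by (simp add: D_def a_def)
    also have "\<dots> = (\<Sum>(i, j)\<in>I. ?x h i * ?x h j * D i j) + (\<Sum>(i, j)\<in>F \<times> F. ?x h i * ?x h j * D i j)"
      unfolding I_def by (subst sum.subset_diff[of "F \<times> F"]) auto
    finally have Y2: "?Y (?Y u) g = (\<Sum>(i, j)\<in>I. ?x h i * ?x h j * D i j) +
        (\<Sum>i\<in>F. \<Sum>j\<in>F. ?x h i * ?x h j * D i j)"
      by (simp add: sum.cartesian_product)
    have I_abs: "\<bar>\<Sum>(i, j)\<in>I. ?x h i * ?x h j * D i j\<bar> \<le> (\<Sum>(i, j)\<in>I. \<bar>?x h i * ?x h j\<bar> * \<bar>D i j\<bar>)"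
      by (intro order_trans[OF sum_abs] sum_mono) (auto simp: abs_mult)
    have inv_h: "inv\<^bsub>G\<^esub> h = Exp (- a)"
      using inv_Exp[of a] Exp_a by simp
    have "0 \<le> ?c" using order_trans[OF abs_ge_zero Y3[of 0]] by simp
    \<comment> \<open>The arithmetic of the final bound: \<open>d\<close> absorbs the discarded
      quadratic terms \<open>J\<close>, and \<open>c\<close> absorbs the difference of the two
      remainders, which after division by 6 is at most \<open>c / 3\<close>.\<close>
    have estimate: "\<bar>2 * U - V - W + S\<bar> \<le> \<bar>c + d\<bar>"
      if "V + W - 2 * U = X + (Y1 - Y2) / 6" "X = J + S" "\<bar>J\<bar> \<le> d" "\<bar>Y1\<bar> \<le> c" "\<bar>Y2\<bar> \<le> c" "0 \<le> c"
      for U V W S X J Y1 Y2 c d :: real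
    proof -
      define Z where "Z = (Y1 - Y2) / 6"
      have "6 * Z = Y1 - Y2" by (simp add: Z_def)
      then have "Z \<le> c" "- Z \<le> c"
        using that(4-6) by linarith+
      moreover have "2 * U - V - W + S = - Z - J"
        using that(1,2) unfolding Z_def[symmetric] by linarith
      moreover have "J \<le> d" "- J \<le> d"
        using that(3) by linarith+
      ultimately have "\<bar>2 * U - V - W + S\<bar> \<le> c + d"
        by (intro abs_leI) linarith+
      then show ?thesis by linarith
    qed
    show "\<bar>2 * u g - u (g \<odot> h) - u (g \<odot> inv\<^bsub>G\<^esub> h) + (\<Sum>i\<in>F. \<Sum>j\<in>F. ?x h i * ?x h j * D i j)\<bar> \<le> \<bar>p h\<bar>"
      unfolding p_def inv_h
      by (rule estimate[OF t12(3)[unfolded Exp_a] Y2 I_abs Y3[OF t12(1)] Y3[OF t12(2)] \<open>0 \<le> ?c\<close>])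
  qed
  then show ?thesis
    using that \<open>t > 2\<close> unfolding D_def by blast
qed

end

section \<open>Second moments\<close>

context homogeneous_norm_group
begin

text \<open>A signed permutation within the first layer changes neither the sum of the squares of
  its coordinates nor the remaining coordinates, and these are the two arguments in the radial
  representation.\<close>

lemma N_signed_involution:
  assumes radial: "first_layer_radial G N"
    and inv: "\<And>j. \<pi> (\<pi> j) = j" and sgn: "\<And>j. \<epsilon> j = 1 \<or> \<epsilon> j = - 1"
    and layer: "\<And>j. \<pi> j \<in> first_layer G \<longleftrightarrow> j \<in> first_layer G"
    and fixed: "\<And>j. j \<notin> first_layer G \<Longrightarrow> \<pi> j = j \<and> \<epsilon> j = 1"
  shows "N (Exp (\<chi> j. \<epsilon> j * a $ \<pi> j)) = N (Exp a)"
proof -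
  let ?F = "first_layer G" and ?b = "\<chi> j. \<epsilon> j * a $ \<pi> j"
  have "(\<Sum>i\<in>?F. (?b $ i)\<^sup>2) = (\<Sum>i\<in>?F. (a $ \<pi> i)\<^sup>2)"
  proof (rule sum.cong[OF refl])
    show "(?b $ i)\<^sup>2 = (a $ \<pi> i)\<^sup>2" for i
      using sgn[of i] by auto
  qed
  also have "\<dots> = (\<Sum>i\<in>?F. (a $ i)\<^sup>2)"
    by (rule sum.reindex_bij_witness[of _ \<pi> \<pi>]) (auto simp: inv layer)
  finally have sum: "(\<Sum>i\<in>?F. (?b $ i)\<^sup>2) = (\<Sum>i\<in>?F. (a $ i)\<^sup>2)" .
  have rest: "(\<chi> j. if j \<in> ?F then 0 else ?b $ j) = (\<chi> j. if j \<in> ?F then 0 else a $ j)"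
    using fixed by (auto simp: vec_eq_iff)
  show ?thesis
  \<comment> \<open>The radial representation is assumed only where some first-layer coordinate is
    nonzero. Where all of them vanish, the map fixes \<open>a\<close>.\<close>
  proof (cases "(\<Sum>i\<in>?F. (a $ i)\<^sup>2) = 0")
    case True
    then have zero: "a $ j = 0" if "j \<in> ?F" for j
      using that by (subst (asm) sum_nonneg_eq_0_iff) auto
    have "\<epsilon> j * a $ \<pi> j = a $ j" for j
      by (cases "j \<in> ?F") (simp_all add: zero layer fixed)
    then have "?b = a"
      by (simp add: vec_eq_iff)
    then show ?thesis by simp
  next
    case False
    obtain H where H: "\<And>g. (\<Sum>i\<in>?F. (coords G g $ i)\<^sup>2) \<noteq> 0 \<Longrightarrow>
        N g = H (\<Sum>i\<in>?F. (coords G g $ i)\<^sup>2) (\<chi> j. if j \<in> ?F then 0 else coords G g $ j)"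
      using radial unfolding first_layer_radial_def by blast
    show ?thesis
      using H[of "Exp ?b"] H[of "Exp a"] False unfolding coords_Exp sum rest by simp
  qed
qed

end

context polar_group
begin

lemma sigma_Q_eq: "sigma_Q N \<sigma> = (LINT h|\<sigma>. 1)"
  by (simp add: sigma_Q_def space_sigma)

lemma exists_first_layer: "first_layer G \<noteq> {}"
  using homogeneous_group by (auto simp: homogeneous_group_def first_layer_def)

lemma sigma_Q_pos: "sigma_Q N \<sigma> > 0"
proof -
  obtain a :: "real ^ 'n" where "a \<noteq> 0"
    using exI[of "\<lambda>a. a \<noteq> 0" "axis undefined 1"] by (auto simp: axis_eq_0_iff)
  then show ?thesis
    unfolding sigma_Q_eq by (intro sphere_integral_pos[where \<kappa> = 0 and ?h0.0 = "Exp a"]) (auto simp: Exp_eq_one)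
qed

definition first_layer_square :: "'g \<Rightarrow> real" where
  "first_layer_square h = (\<Sum>i\<in>first_layer G. (coords G h $ i)\<^sup>2)"

lemma tau_m_eq: "tau_m G \<sigma> = (LINT h|\<sigma>. first_layer_square h)"
  by (simp add: tau_m_def first_layer_square_def)

lemma continuous_first_layer_square: "continuous_on UNIV first_layer_square"
  unfolding first_layer_square_def by (intro continuous_intros continuous_coords)

lemma first_layer_square_nonneg: "0 \<le> first_layer_square h"
  unfolding first_layer_square_def by (intro sum_nonneg) auto

lemma first_layer_square_dilation:
  "r > 0 \<Longrightarrow> first_layer_square (dilation G r h) = r powr 2 * first_layer_square h"
  by (auto simp: first_layer_square_def coords_dilation dil_def first_layer_def power_mult_distrib sum_distrib_left)

lemma tau_m_pos: "tau_m G \<sigma> > 0"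
proof -
  obtain i where i: "i \<in> first_layer G" using exists_first_layer by blast
  let ?a = "axis i 1 :: real ^ 'n"
  have "first_layer_square (Exp ?a) \<ge> (?a $ i)\<^sup>2"
    unfolding first_layer_square_def coords_Exp using i by (intro member_le_sum) auto
  then have "first_layer_square (Exp ?a) > 0" by simp
  then show ?thesis
    unfolding tau_m_eq
    by (intro sphere_integral_pos[OF continuous_first_layer_square first_layer_square_nonneg
          first_layer_square_dilation]) (auto simp: Exp_eq_one axis_eq_0_iff)
qed

text \<open>A comparison for functions without homogeneity: the dominating function is a multiple of
  a power of the norm, so its ball integral is explicit, and the constant 1 on the sphere produces
  the factor \<open>sigma_Q\<close>.\<close>

lemma ball_integral_bound:
  assumes p [measurable]: "p \<in> borel_measurable borel"
    and bound: "\<And>h. N h \<le> R \<Longrightarrow> \<bar>p h\<bar> \<le> K * N h powr t"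
    and R: "0 < R" and e: "t - \<rho> + hom_dim G = e" "e > 0"
  shows "integrable (haar G) (\<lambda>h. indicator {..R} (N h) * (p h / N h powr \<rho>))"
    and "\<bar>LINT h|haar G. indicator {..R} (N h) * (p h / N h powr \<rho>)\<bar> \<le> K * sigma_Q N \<sigma> * (R powr e / e)"
proof -
  let ?f = "\<lambda>h. indicator {..R} (N h) * (p h / N h powr \<rho>)"
  let ?g = "\<lambda>h. K * (indicator {..R} (N h) * (1 / N h powr (\<rho> - t)))"
  have e': "0 - (\<rho> - t) + hom_dim G = e" using e(1) by simp
  have one: "continuous_on UNIV (\<lambda>h :: 'g. 1 :: real)" "\<And>h :: 'g. 0 \<le> (1 :: real)"
    "\<And>r h. r > 0 \<Longrightarrow> (1 :: real) = r powr 0 * 1"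
    by auto
  note g = ball_integral[OF one R e' e(2)]
  have le: "\<bar>?f h\<bar> \<le> ?g h" for h
  proof (cases "N h = 0 \<or> N h > R")
    case False
    then have "N h > 0" "N h \<le> R" by (auto simp: less_le)
    then have "\<bar>p h\<bar> / N h powr \<rho> \<le> K * N h powr t / N h powr \<rho>"
      using bound by (intro divide_right_mono) auto
    then show ?thesis
      using \<open>N h > 0\<close> \<open>N h \<le> R\<close> by (simp add: powr_diff abs_mult)
  qed auto
  have int_g: "integrable (haar G) ?g"
    using g(1) by (intro integrable_mult_right) simp
  show int_f: "integrable (haar G) ?f"
  proof (rule Bochner_Integration.integrable_bound[OF int_g])
    show "AE h in haar G. norm (?f h) \<le> norm (?g h)"
      unfolding real_norm_def by (intro AE_I2 order_trans[OF le abs_ge_self])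
  qed measurable
  have "\<bar>LINT h|haar G. ?f h\<bar> \<le> (LINT h|haar G. ?g h)"
    using le by (intro order_trans[OF integral_abs_bound] integral_mono integrable_abs int_f int_g) auto
  also have "\<dots> = K * sigma_Q N \<sigma> * (R powr e / e)"
    by (simp only: integral_mult_right_zero g(2) sigma_Q_eq mult.assoc)
  finally show "\<bar>LINT h|haar G. ?f h\<bar> \<le> K * sigma_Q N \<sigma> * (R powr e / e)" .
qed

definition ball_moment :: "real \<Rightarrow> real \<Rightarrow> 'n \<Rightarrow> 'n \<Rightarrow> real" where
  "ball_moment R \<rho> i j =
    (LINT h|haar G. indicator {..R} (N h) * (coords G h $ i * coords G h $ j / N h powr \<rho>))"

lemma integrable_ball_moment:
  assumes "i \<in> first_layer G" "j \<in> first_layer G" "0 < R" "2 - \<rho> + hom_dim G > 0"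
  shows "integrable (haar G) (\<lambda>h. indicator {..R} (N h) * (coords G h $ i * coords G h $ j / N h powr \<rho>))"
proof -
  have "ball_order R (weight G i + weight G j) (\<lambda>h. coords G h $ i * coords G h $ j)"
    by (intro ball_order_mult ball_order_coords)
  then obtain K where K: "\<And>h. N h \<le> R \<Longrightarrow> \<bar>coords G h $ i * coords G h $ j\<bar> \<le> K * N h powr 2"
    using assms(1,2) unfolding ball_order_def first_layer_def by auto
  show ?thesis
    by (rule ball_integral_bound(1)[OF _ K assms(3) refl assms(4)]) measurable
qed

lemma ball_moment_off_diagonal:
  assumes "first_layer_radial G N" and i: "i \<in> first_layer G" "i \<noteq> j"
  shows "ball_moment R \<rho> i j = 0"
proof -
  let ?\<epsilon> = "\<lambda>k. if k = i then - 1 else 1 :: real"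
  let ?f = "\<lambda>h. indicator {..R} (N h) * (coords G h $ i * coords G h $ j / N h powr \<rho>)"
  have f: "?f \<in> borel_measurable borel" by measurable
  have "N (Exp (\<chi> k. ?\<epsilon> k * coords G h $ id k)) = N (Exp (coords G h))" for h
    by (rule N_signed_involution[OF assms(1)]) (use i in auto)
  then have "?f (Exp (\<chi> k. ?\<epsilon> k * coords G h $ id k)) = - ?f h" for h
    using i by simp
  then have "ball_moment R \<rho> i j = - ball_moment R \<rho> i j"
    unfolding ball_moment_def
    by (subst integral_haar_signed_involution[OF _ _ f, of id ?\<epsilon>]) auto
  then show ?thesis by simp
qed

text \<open>Transpositions make the pure moments equal, so \<open>card (first_layer G)\<close> times
  one of them is the ball integral of the whole first-layer square, which is homogeneous of degree
  2. This is how \<open>tau_m\<close> and the division by \<open>m\<close> arise.\<close>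

lemma ball_moment_diagonal:
  assumes radial: "first_layer_radial G N" and i: "i \<in> first_layer G"
    and R: "0 < R" and e: "2 - \<rho> + hom_dim G = e" "e > 0"
  shows "real (card (first_layer G)) * ball_moment R \<rho> i i = tau_m G \<sigma> * (R powr e / e)"
proof -
  let ?F = "first_layer G"
  have eq: "ball_moment R \<rho> k k = ball_moment R \<rho> i i" if k: "k \<in> ?F" for k
  proof -
    let ?\<pi> = "Transposition.transpose i k"
    let ?f = "\<lambda>h. indicator {..R} (N h) * (coords G h $ k * coords G h $ k / N h powr \<rho>)"
    have f: "?f \<in> borel_measurable borel" by measurable
    have "N (Exp (\<chi> j. 1 * coords G h $ ?\<pi> j)) = N (Exp (coords G h))" for h
      by (rule N_signed_involution[OF radial]) (use i k in \<open>auto simp: Transposition.transpose_def\<close>)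
    then have "?f (Exp (\<chi> j. 1 * coords G h $ ?\<pi> j)) =
        indicator {..R} (N h) * (coords G h $ i * coords G h $ i / N h powr \<rho>)" for h
      by simp
    then show ?thesis
      unfolding ball_moment_def
      by (subst integral_haar_signed_involution[OF _ _ f, of ?\<pi> "\<lambda>_. 1"]) auto
  qed
  have "real (card ?F) * ball_moment R \<rho> i i = (\<Sum>k\<in>?F. ball_moment R \<rho> k k)"
    by (simp add: eq)
  also have "\<dots> = (LINT h|haar G. (\<Sum>k\<in>?F. indicator {..R} (N h) * (coords G h $ k * coords G h $ k / N h powr \<rho>)))"
    unfolding ball_moment_def using R e
    by (intro Bochner_Integration.integral_sum[symmetric] integrable_ball_moment) auto
  also have "\<dots> = (LINT h|haar G. indicator {..R} (N h) * (first_layer_square h / N h powr \<rho>))"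
    by (simp add: first_layer_square_def sum_distrib_left sum_divide_distrib power2_eq_square)
  also have "\<dots> = tau_m G \<sigma> * (R powr e / e)"
    unfolding tau_m_eq
    by (rule ball_integral(2)[OF continuous_first_layer_square first_layer_square_nonneg
          first_layer_square_dilation R e])
  finally show ?thesis .
qed

end

section \<open>The two limits\<close>

text \<open>The bound on \<open>A s\<close> stays bounded near \<open>s = 0\<close>, its denominator
  tending to 2, so the factor \<open>s\<close> kills this part. The tail has the pole
  \<open>1 / (2 * s)\<close>, which the same factor cancels.\<close>

lemma limit_at_0:
  fixes A :: "real \<Rightarrow> real"
  assumes "\<omega> > 0" "R > 0"
    and A: "\<And>s. 0 < s \<Longrightarrow> s < 1 \<Longrightarrow> \<bar>A s\<bar> \<le> K * \<omega> * (R powr (2 - 2 * s) / (2 - 2 * s))"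
  shows "((\<lambda>s. s / \<omega> * (A s + 2 * U * (\<omega> * (R powr (- 2 * s) / (2 * s))))) \<longlongrightarrow> U) (at_right 0)"
proof -
  have ev: "\<forall>\<^sub>F s in at_right 0. s \<in> {0<..<1::real}"
    by (rule eventually_at_right_real) simp
  have "((\<lambda>s. s * K * (R powr (2 - 2 * s) / (2 - 2 * s))) \<longlongrightarrow>
      0 * K * (R powr (2 - 2 * 0) / (2 - 2 * 0))) (at_right 0)"
    using \<open>R > 0\<close> by (intro tendsto_intros) auto
  then have bound: "((\<lambda>s. s * K * (R powr (2 - 2 * s) / (2 - 2 * s))) \<longlongrightarrow> 0) (at_right 0)"
    by simp
  have "((\<lambda>s. s / \<omega> * A s) \<longlongrightarrow> 0) (at_right 0)"
  proof (rule Lim_null_comparison[OF _ bound])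
    show "\<forall>\<^sub>F s in at_right 0. norm (s / \<omega> * A s) \<le> s * K * (R powr (2 - 2 * s) / (2 - 2 * s))"
      using ev
    proof eventually_elim
      fix s :: real assume "s \<in> {0<..<1}"
      then have s: "0 < s" "s < 1" by auto
      then have "s / \<omega> * \<bar>A s\<bar> \<le> s / \<omega> * (K * \<omega> * (R powr (2 - 2 * s) / (2 - 2 * s)))"
        using \<open>\<omega> > 0\<close> by (intro mult_left_mono A) auto
      also have "\<dots> = s * K * (R powr (2 - 2 * s) / (2 - 2 * s))"
        using \<open>\<omega> > 0\<close> by simp
      finally show "norm (s / \<omega> * A s) \<le> s * K * (R powr (2 - 2 * s) / (2 - 2 * s))"
        using s \<open>\<omega> > 0\<close> by (simp add: abs_mult)
    qed
  qed
  moreover have "((\<lambda>s. U * R powr (- 2 * s)) \<longlongrightarrow> U * R powr (- 2 * 0)) (at_right 0)"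
    using \<open>R > 0\<close> by (intro tendsto_intros) auto
  ultimately have "((\<lambda>s. s / \<omega> * A s + U * R powr (- 2 * s)) \<longlongrightarrow> 0 + U * R powr (- 2 * 0)) (at_right 0)"
    by (rule tendsto_add)
  then have lim: "((\<lambda>s. s / \<omega> * A s + U * R powr (- 2 * s)) \<longlongrightarrow> U) (at_right 0)"
    using \<open>R > 0\<close> by simp
  have "\<forall>\<^sub>F s in at_right 0. s / \<omega> * A s + U * R powr (- 2 * s) =
      s / \<omega> * (A s + 2 * U * (\<omega> * (R powr (- 2 * s) / (2 * s))))"
    using ev by eventually_elim (use \<open>\<omega> > 0\<close> in \<open>simp add: distrib_left\<close>)
  then show ?thesis
    by (rule Lim_transform_eventually[OF lim])
qed

text \<open>The multiplier is fitted to the pole: against \<open>\<tau> / m / (2 - 2 * s)\<close> it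
  leaves exactly 1, and \<open>R powr (2 - 2 * s)\<close> tends to 1. The error stays bounded
  because \<open>t - 2 * s\<close> tends to \<open>t - 2 > 0\<close>, and the tail is regular at 1,
  so both vanish with \<open>1 - s\<close>.\<close>

lemma limit_at_1:
  fixes A :: "real \<Rightarrow> real"
  assumes "\<tau> > 0" "m > 0" "R > 0" "t > 2"
    and A: "\<And>s. 0 < s \<Longrightarrow> s < 1 \<Longrightarrow>
      \<bar>A s + V * (\<tau> / m * (R powr (2 - 2 * s) / (2 - 2 * s)))\<bar> \<le> K * (R powr (t - 2 * s) / (t - 2 * s))"
  shows "((\<lambda>s. 2 * m * (1 - s) / \<tau> * (A s + 2 * U * (\<omega> * (R powr (- 2 * s) / (2 * s))))) \<longlongrightarrow> - V)
    (at_left 1)"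
proof -
  let ?c = "\<lambda>s. 2 * m * (1 - s) / \<tau>"
  let ?B = "\<lambda>s. A s + V * (\<tau> / m * (R powr (2 - 2 * s) / (2 - 2 * s)))"
  have ev: "\<forall>\<^sub>F s in at_left 1. s \<in> {0<..<1::real}"
    by (rule eventually_at_left_real) simp
  have "((\<lambda>s. ?c s * (K * (R powr (t - 2 * s) / (t - 2 * s)))) \<longlongrightarrow>
      ?c 1 * (K * (R powr (t - 2 * 1) / (t - 2 * 1)))) (at_left 1)"
    using \<open>R > 0\<close> \<open>\<tau> > 0\<close> \<open>t > 2\<close> by (intro tendsto_intros) auto
  then have bound: "((\<lambda>s. ?c s * (K * (R powr (t - 2 * s) / (t - 2 * s)))) \<longlongrightarrow> 0) (at_left 1)"
    by simp
  have "((\<lambda>s. ?c s * ?B s) \<longlongrightarrow> 0) (at_left 1)"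
  proof (rule Lim_null_comparison[OF _ bound])
    show "\<forall>\<^sub>F s in at_left 1. norm (?c s * ?B s) \<le> ?c s * (K * (R powr (t - 2 * s) / (t - 2 * s)))"
      using ev
    proof eventually_elim
      fix s :: real assume "s \<in> {0<..<1}"
      then have s: "0 < s" "s < 1" by auto
      then have c: "?c s \<ge> 0"
        using \<open>m > 0\<close> \<open>\<tau> > 0\<close> by simp
      show "norm (?c s * ?B s) \<le> ?c s * (K * (R powr (t - 2 * s) / (t - 2 * s)))"
        unfolding real_norm_def abs_mult abs_of_nonneg[OF c] using A[OF s] c by (rule mult_left_mono)
    qed
  qed
  moreover have "((\<lambda>s. ?c s * (2 * U * (\<omega> * (R powr (- 2 * s) / (2 * s))))) \<longlongrightarrow>
      ?c 1 * (2 * U * (\<omega> * (R powr (- 2 * 1) / (2 * 1))))) (at_left 1)"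
    using \<open>R > 0\<close> \<open>\<tau> > 0\<close> by (intro tendsto_intros) auto
  moreover have "((\<lambda>s. V * R powr (2 - 2 * s)) \<longlongrightarrow> V * R powr (2 - 2 * 1)) (at_left 1)"
    using \<open>R > 0\<close> by (intro tendsto_intros) auto
  ultimately have "((\<lambda>s. ?c s * ?B s + ?c s * (2 * U * (\<omega> * (R powr (- 2 * s) / (2 * s)))) -
      V * R powr (2 - 2 * s)) \<longlongrightarrow>
      0 + ?c 1 * (2 * U * (\<omega> * (R powr (- 2 * 1) / (2 * 1)))) - V * R powr (2 - 2 * 1)) (at_left 1)"
    by (intro tendsto_diff tendsto_add)
  then have lim: "((\<lambda>s. ?c s * ?B s + ?c s * (2 * U * (\<omega> * (R powr (- 2 * s) / (2 * s)))) -
      V * R powr (2 - 2 * s)) \<longlongrightarrow> - V) (at_left 1)"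
    using \<open>R > 0\<close> by simp
  have "\<forall>\<^sub>F s in at_left 1. ?c s * ?B s + ?c s * (2 * U * (\<omega> * (R powr (- 2 * s) / (2 * s)))) -
      V * R powr (2 - 2 * s) = ?c s * (A s + 2 * U * (\<omega> * (R powr (- 2 * s) / (2 * s))))"
    using ev
  proof eventually_elim
    fix s :: real assume "s \<in> {0<..<1}"
    then have "?c s * (V * (\<tau> / m * (R powr (2 - 2 * s) / (2 - 2 * s)))) = V * R powr (2 - 2 * s)"
      using \<open>m > 0\<close> \<open>\<tau> > 0\<close> by (simp add: field_simps)
    then show "?c s * ?B s + ?c s * (2 * U * (\<omega> * (R powr (- 2 * s) / (2 * s)))) -
        V * R powr (2 - 2 * s) = ?c s * (A s + 2 * U * (\<omega> * (R powr (- 2 * s) / (2 * s))))"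
      by (simp only: distrib_left)
  qed
  then show ?thesis
    by (rule Lim_transform_eventually[OF lim])
qed

context polar_group
begin

text \<open>\<open>A\<close> is the part of the integral over \<open>N h \<le> R\<close>. All that
  depends on the group is condensed into two estimates for it, so that only limits of real functions
  of \<open>s\<close> remain.\<close>

lemma fractional_op_split:
  assumes radial: "first_layer_radial G N" and u: "u \<in> test_functions G"
  obtains A R t K L where "R > 0" "t > 2"
    "\<And>s. 0 < s \<Longrightarrow> s < 1 \<Longrightarrow>
      fractional_op G N s u g = A s + 2 * u g * (sigma_Q N \<sigma> * (R powr (- 2 * s) / (2 * s)))"
    "\<And>s. 0 < s \<Longrightarrow> s < 1 \<Longrightarrow> \<bar>A s\<bar> \<le> K * sigma_Q N \<sigma> * (R powr (2 - 2 * s) / (2 - 2 * s))"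
    "\<And>s. 0 < s \<Longrightarrow> s < 1 \<Longrightarrow>
      \<bar>A s + (\<Sum>i\<in>first_layer G. basis_field G i (basis_field G i u) g) *
        (tau_m G \<sigma> / real (card (first_layer G)) * (R powr (2 - 2 * s) / (2 - 2 * s)))\<bar>
      \<le> L * (R powr (t - 2 * s) / (t - 2 * s))"
proof -
  let ?F = "first_layer G" and ?x = "\<lambda>h i. coords G h $ i"
  define D where "D i j = basis_field G i (basis_field G j u) g" for i j
  define q where "q h = 2 * u g - u (g \<odot> h) - u (g \<odot> inv\<^bsub>G\<^esub> h)" for h
  define E where "E h = q h + (\<Sum>i\<in>?F. \<Sum>j\<in>?F. ?x h i * ?x h j * D i j)" for h
  define A where "A R s = (LINT h|haar G. indicator {..R} (N h) * (q h / N h powr (hom_dim G + 2 * s)))" for R s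
  have smooth: "u \<in> smooth_functions G"
    using u by (simp add: test_functions_def)
  then have cont: "continuous_on UNIV u"
    by (simp add: smooth_functions_iff)
  have "continuous_on UNIV q"
    unfolding q_def
    by (intro continuous_intros continuous_on_compose2[OF cont] continuous_mult
        continuous_on_compose2[OF continuous_mult continuous_inv]) auto
  then have q [measurable]: "q \<in> borel_measurable borel"
    by (rule borel_measurable_continuous_onI)
  have E [measurable]: "E \<in> borel_measurable borel"
    unfolding E_def by measurable
  obtain R where R: "R > 0" "\<And>h. R < N h \<Longrightarrow> u (g \<odot> h) = 0"
    using compact_support_radius[OF u] by blast
  obtain t where t: "t > 2" "ball_order R t E"
    using taylor_remainder[OF smooth R(1), of g] unfolding E_def q_def D_def by blast
  \<comment> \<open>The order 2 of \<open>q\<close> is read off from its expansion: the error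
    \<open>E\<close> has order \<open>t > 2\<close>, and the quadratic terms restored here have
    order 1 + 1.\<close>
  have "ball_order R 2 (\<lambda>h. E h + (\<Sum>i\<in>?F. \<Sum>j\<in>?F. ?x h i * ?x h j * - D i j))"
  proof (intro ball_order_add ball_order_sum ball_order_mult_const)
    show "ball_order R 2 E"
      using ball_order_mono[OF t(2) _ R(1)] t(1) by simp
    show "ball_order R 2 (\<lambda>h. ?x h i * ?x h j)" if "i \<in> ?F" "j \<in> ?F" for i j
      using ball_order_mult[OF ball_order_coords[of R i] ball_order_coords[of R j]] that
      by (simp add: first_layer_def)
  qed
  then have "ball_order R 2 q"
    by (simp add: E_def sum_negf)
  then obtain K where K: "\<And>h. N h \<le> R \<Longrightarrow> \<bar>q h\<bar> \<le> K * N h powr 2"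
    unfolding ball_order_def by blast
  obtain L where L: "\<And>h. N h \<le> R \<Longrightarrow> \<bar>E h\<bar> \<le> L * N h powr t"
    using t(2) unfolding ball_order_def by blast
  show ?thesis
  proof (rule that[OF R(1) t(1)])
    fix s :: real assume s: "0 < s" "s < 1"
    let ?\<rho> = "hom_dim G + 2 * s"
    have e2: "2 - ?\<rho> + hom_dim G = 2 - 2 * s" "2 - 2 * s > 0"
      and et: "t - ?\<rho> + hom_dim G = t - 2 * s" "t - 2 * s > 0"
      and e0: "0 - ?\<rho> + hom_dim G = - 2 * s" "- 2 * s < 0"
      using s t(1) by auto
    note int_q = ball_integral_bound[OF q K R(1) e2] and int_E = ball_integral_bound[OF E L R(1) et]
    show "\<bar>A R s\<bar> \<le> K * sigma_Q N \<sigma> * (R powr (2 - 2 * s) / (2 - 2 * s))"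
      unfolding A_def by (rule int_q(2))
    have one: "continuous_on UNIV (\<lambda>h :: 'g. 1 :: real)" "\<And>h :: 'g. 0 \<le> (1 :: real)"
      "\<And>r h. r > 0 \<Longrightarrow> (1 :: real) = r powr 0 * 1"
      by auto
    note far = complement_integral[OF one R(1) e0]
    \<comment> \<open>Beyond radius \<open>R\<close> both translates vanish, the second one because
      \<open>N\<close> is invariant under inversion.\<close>
    have split: "q h / N h powr ?\<rho> = indicator {..R} (N h) * (q h / N h powr ?\<rho>) +
        2 * u g * (indicator {R<..} (N h) * (1 / N h powr ?\<rho>))" for h
      using R(2)[of h] R(2)[of "inv\<^bsub>G\<^esub> h"] by (auto simp: q_def N_inv indicator_def)
    have "fractional_op G N s u g = (LINT h|haar G. q h / N h powr ?\<rho>)"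
      by (simp add: fractional_op_def q_def)
    also have "\<dots> = (LINT h|haar G. indicator {..R} (N h) * (q h / N h powr ?\<rho>) +
        2 * u g * (indicator {R<..} (N h) * (1 / N h powr ?\<rho>)))"
      by (rule Bochner_Integration.integral_cong[OF refl split])
    also have "\<dots> = A R s + (LINT h|haar G. 2 * u g * (indicator {R<..} (N h) * (1 / N h powr ?\<rho>)))"
      unfolding A_def
      by (intro Bochner_Integration.integral_add int_q(1) integrable_mult_right far(1))
    also have "\<dots> = A R s + 2 * u g * (sigma_Q N \<sigma> * (R powr (- 2 * s) / - (- 2 * s)))"
      by (simp only: integral_mult_right_zero far(2) sigma_Q_eq)
    finally show "fractional_op G N s u g =
        A R s + 2 * u g * (sigma_Q N \<sigma> * (R powr (- 2 * s) / (2 * s)))"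
      by simp
    have int_moment: "integrable (haar G) (\<lambda>h. indicator {..R} (N h) * (?x h i * ?x h j / N h powr ?\<rho>) * D i j)"
      if "i \<in> ?F" "j \<in> ?F" for i j
      using integrable_ball_moment[OF that R(1)] e2 by (intro integrable_mult_left) simp
    have q_eq: "q h = E h - (\<Sum>i\<in>?F. \<Sum>j\<in>?F. ?x h i * ?x h j * D i j)" for h
      by (simp add: E_def)
    have "indicator {..R} (N h) * ((\<Sum>i\<in>?F. \<Sum>j\<in>?F. ?x h i * ?x h j * D i j) / N h powr ?\<rho>) =
        (\<Sum>i\<in>?F. \<Sum>j\<in>?F. indicator {..R} (N h) * (?x h i * ?x h j / N h powr ?\<rho>) * D i j)" for h
      unfolding sum_divide_distrib sum_distrib_left by (intro sum.cong refl) simp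
    then have integrand: "indicator {..R} (N h) * (q h / N h powr ?\<rho>) = indicator {..R} (N h) * (E h / N h powr ?\<rho>) -
        (\<Sum>i\<in>?F. \<Sum>j\<in>?F. indicator {..R} (N h) * (?x h i * ?x h j / N h powr ?\<rho>) * D i j)" for h
      unfolding q_eq diff_divide_distrib right_diff_distrib by simp
    have "A R s = (LINT h|haar G. indicator {..R} (N h) * (E h / N h powr ?\<rho>)) -
        (LINT h|haar G. (\<Sum>i\<in>?F. \<Sum>j\<in>?F. indicator {..R} (N h) * (?x h i * ?x h j / N h powr ?\<rho>) * D i j))"
      unfolding A_def integrand
      by (intro Bochner_Integration.integral_diff Bochner_Integration.integrable_sum int_E(1) int_moment)
    also have "(LINT h|haar G. (\<Sum>i\<in>?F. \<Sum>j\<in>?F. indicator {..R} (N h) * (?x h i * ?x h j / N h powr ?\<rho>) * D i j)) =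
        (\<Sum>i\<in>?F. \<Sum>j\<in>?F. ball_moment R ?\<rho> i j * D i j)"
    proof -
      let ?m = "\<lambda>i j h. indicator {..R} (N h) * (?x h i * ?x h j / N h powr ?\<rho>) * D i j"
      have "(LINT h|haar G. (\<Sum>i\<in>?F. \<Sum>j\<in>?F. ?m i j h)) = (\<Sum>i\<in>?F. LINT h|haar G. (\<Sum>j\<in>?F. ?m i j h))"
        by (intro Bochner_Integration.integral_sum Bochner_Integration.integrable_sum int_moment)
      also have "\<dots> = (\<Sum>i\<in>?F. \<Sum>j\<in>?F. LINT h|haar G. ?m i j h)"
        by (intro sum.cong refl Bochner_Integration.integral_sum int_moment)
      also have "\<dots> = (\<Sum>i\<in>?F. \<Sum>j\<in>?F. ball_moment R ?\<rho> i j * D i j)"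
        unfolding ball_moment_def by (simp only: integral_mult_left_zero)
      finally show ?thesis .
    qed
    also have "\<dots> = (\<Sum>i\<in>?F. ball_moment R ?\<rho> i i * D i i)"
    proof (rule sum.cong[OF refl])
      \<comment> \<open>Only the pure second derivatives survive. The mixed ones drop out whatever
        their values, so the non-commutativity of the fields leaves no trace in the limit.\<close>
      fix i assume i: "i \<in> ?F"
      have "(\<Sum>j\<in>?F. ball_moment R ?\<rho> i j * D i j) = (\<Sum>j\<in>?F. if i = j then ball_moment R ?\<rho> i i * D i i else 0)"
        by (rule sum.cong) (auto simp: ball_moment_off_diagonal[OF radial i])
      then show "(\<Sum>j\<in>?F. ball_moment R ?\<rho> i j * D i j) = ball_moment R ?\<rho> i i * D i i"
        using i by simp
    qed
    also have "\<dots> = (\<Sum>i\<in>?F. D i i) * (tau_m G \<sigma> / real (card ?F) * (R powr (2 - 2 * s) / (2 - 2 * s)))"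
    proof -
      have card: "real (card ?F) \<noteq> 0" using exists_first_layer by simp
      have "z = x / y * w" if "y * z = x * w" "y \<noteq> 0" for x y z w :: real
        using that by (simp add: field_simps)
      from this[OF ball_moment_diagonal[OF radial _ R(1) e2] card]
      have moment: "ball_moment R ?\<rho> i i = tau_m G \<sigma> / real (card ?F) * (R powr (2 - 2 * s) / (2 - 2 * s))"
        if "i \<in> ?F" for i
        using that .
      show ?thesis
        unfolding sum_distrib_right by (intro sum.cong refl) (simp only: moment mult.commute[of "D _ _"])
    qed
    finally show "\<bar>A R s + (\<Sum>i\<in>?F. basis_field G i (basis_field G i u) g) *
        (tau_m G \<sigma> / real (card ?F) * (R powr (2 - 2 * s) / (2 - 2 * s)))\<bar>
        \<le> L * sigma_Q N \<sigma> * (R powr (t - 2 * s) / (t - 2 * s))"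
      using int_E(2) unfolding D_def by simp
  qed
qed

end

theorem theorem1p2:
  fixes G :: "('g::{t2_space,second_countable_topology}, 'n::finite) hdata"
    and N :: "'g \<Rightarrow> real" and \<sigma> :: "'g measure" and u :: "'g \<Rightarrow> real" and g :: 'g
  assumes "homogeneous_group G"
    and "homogeneous_norm G N"
    and "sphere_measure G N \<sigma>"
    and "first_layer_radial G N"
    and "u \<in> test_functions G"
  shows "((\<lambda>s. s / sigma_Q N \<sigma> * fractional_op G N s u g) \<longlongrightarrow> u g) (at_right 0) \<and>
    ((\<lambda>s. 2 * real (card (first_layer G)) * (1 - s) / tau_m G \<sigma> * fractional_op G N s u g) \<longlongrightarrow>
       - (\<Sum>i\<in>first_layer G. basis_field G i (basis_field G i u) g)) (at_left 1)"
proof -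
  interpret polar_group G N \<sigma>
    by unfold_locales (rule assms)+
  obtain A R t K L where R: "R > 0" and t: "t > 2"
    and split: "\<And>s. 0 < s \<Longrightarrow> s < 1 \<Longrightarrow>
      fractional_op G N s u g = A s + 2 * u g * (sigma_Q N \<sigma> * (R powr (- 2 * s) / (2 * s)))"
    and A0: "\<And>s. 0 < s \<Longrightarrow> s < 1 \<Longrightarrow> \<bar>A s\<bar> \<le> K * sigma_Q N \<sigma> * (R powr (2 - 2 * s) / (2 - 2 * s))"
    and A1: "\<And>s. 0 < s \<Longrightarrow> s < 1 \<Longrightarrow>
      \<bar>A s + (\<Sum>i\<in>first_layer G. basis_field G i (basis_field G i u) g) *
        (tau_m G \<sigma> / real (card (first_layer G)) * (R powr (2 - 2 * s) / (2 - 2 * s)))\<bar>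
      \<le> L * (R powr (t - 2 * s) / (t - 2 * s))"
    by (rule fractional_op_split[OF assms(4,5), of g]) (rule that)
  have m: "real (card (first_layer G)) > 0"
    using exists_first_layer by (simp add: card_gt_0_iff)
  \<comment> \<open>The decomposition is available only for \<open>0 < s < 1\<close>, a condition
    that both one-sided filters eventually grant.\<close>
  have "\<forall>\<^sub>F s in at_right 0. s \<in> {0<..<1::real}"
    by (rule eventually_at_right_real) simp
  then have ev0: "\<forall>\<^sub>F s in at_right 0.
      s / sigma_Q N \<sigma> * (A s + 2 * u g * (sigma_Q N \<sigma> * (R powr (- 2 * s) / (2 * s)))) =
      s / sigma_Q N \<sigma> * fractional_op G N s u g"
    by eventually_elim (simp add: split)
  have "\<forall>\<^sub>F s in at_left 1. s \<in> {0<..<1::real}"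
    by (rule eventually_at_left_real) simp
  then have ev1: "\<forall>\<^sub>F s in at_left 1. 2 * real (card (first_layer G)) * (1 - s) / tau_m G \<sigma> *
        (A s + 2 * u g * (sigma_Q N \<sigma> * (R powr (- 2 * s) / (2 * s)))) =
      2 * real (card (first_layer G)) * (1 - s) / tau_m G \<sigma> * fractional_op G N s u g"
    by eventually_elim (simp add: split)
  show ?thesis
    using Lim_transform_eventually[OF limit_at_0[OF sigma_Q_pos R A0] ev0]
      Lim_transform_eventually[OF limit_at_1[OF tau_m_pos m R t A1] ev1] by (rule conjI)
qed

end
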